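(* Let $n\ge1$ be an integer, $h=1/n$, $\mu\in(0,4)$, and $\kappa=\lceil \mu/2+1\rceil$. Let $f\in C^{\kappa}[0,1]$ and let $f^*\in C^{\kappa}(\mathbb{R})$ be a compactly supported extension of $f$, i.e. $f^*(x)=f(x)$ for all $x\in[0,1]$. Let $s_{h,2}$ be the thin plate spline interpolant to $f$ at the knots $0,h,2h,\ldots,1$, and let $\mathcal{M}_{h,\mu}$ be the mixed power function. Then $$|f(x)-s_{h,2}(x)|\le c_{f,\mu}\,\mathcal{M}_{h,\mu}(x),\quad x\in[0,1],$$ where $$c_{f,\mu}=\left\{\frac{1}{2\pi|A_\mu|}\int_{\mathbb{R}}|\widehat{f^*}(t)|^2\,|t|^{1+\mu}\,dt\right\}^{1/2}<\infty .$$
   Context: Fourier transform convention: $\widehat g(t)=\int_{\mathbb{R}}e^{-ixt}g(x)\,dx$. $\lceil y\rceil$ is the least integer greater than or equal to $y$. For $\gamma>0$ let $\phi_\gamma(x)=|x|^\gamma$ if $\gamma$ is not an even positive integer, and $\phi_\gamma(x)=|x|^\gamma\log|x|$ (with $\phi_\gamma(0)=0$) if $\gamma$ is an even positive integer. $A_\gamma$ denotes the nonzero real constant such that the generalized (distributional) Fourier transform of $\phi_\gamma$ coincides with $A_\gamma/|t|^{1+\gamma}$ on $\mathbb{R}\setminus\{0\}$ (a known fact). Thin plate spline (TPS) interpolant: $s_{h,2}$ is the unique function of the form $$s_{h,2}(x)=\sum_{k=0}^n a_k\,\phi_2(x-hk)+b_0+b_1x,\quad x\in\mathbb{R},$$ with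 $\phi_2(x)=|x|^2\log|x|$, real coefficients satisfying the side conditions $\sum_{k=0}^n a_k=0$, $\sum_{k=0}^n k\,a_k=0$, and the interpolation conditions $s_{h,2}(hi)=f(hi)$, $i=0,1,\ldots,n$. (Existence and uniqueness are known from Micchelli's theory.) For $j\in\{0,\ldots,n\}$, the TPS Lagrange function $\ell^{(2)}_{j,h}$ is the unique function of this same form, satisfying the same side conditions, with $\ell^{(2)}_{j,h}(ih)=\delta_{ij}$ for $i=0,\ldots,n$. Thus $s_{h,2}(x)=\sum_{j=0}^n f(hj)\,\ell^{(2)}_{j,h}(x)$; moreover it is known that $\sum_{j=0}^n\ell^{(2)}_{j,h}(x)=1$ and $\sum_{j=0}^n hj\,\ell^{(2)}_{j,h}(x)=x$ for all $x\in\mathbb{R}$. For $x\in\mathbb{R}$ define $$\Theta_{x,2}(t)=e^{ixt}-\sum_{j=0}^n\ell^{(2)}_{j,h}(x)\,e^{ihjt},\quad t\in\mathbb{R}.$$ The mixed power function $\mathcal{M}_{h,\mu}:\mathbb{R}\to[0,\infty)$, $\mu\in(0,4)$, is defined by $$\mathcal{M}_{h,\mu}^2(x)=\frac{|A_\mu|}{2\pi}\int_{\mathbb{R}}\frac{|\Theta_{x,2}(t)|^2}{|t|^{1+\mu}}\,dt,\quad x\in\mathbb{R},$$ where the integral converges because $|\Theta_{x,2}(t)|=O(|t|^2)$ as $t\to0$ and $O(1)$ as $|t|\to\infty$. *)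

theory Defs
  imports "HOL-Analysis.Analysis"
begin

text \<open>
  Membership in \<open>C\<^sup>k(S)\<close>; the derivatives are taken within \<open>S\<close>, i.e. one-sided
  at the end points of a closed interval.
\<close>
definition Ck_on :: "nat \<Rightarrow> (real \<Rightarrow> 'a::real_normed_vector) \<Rightarrow> real set \<Rightarrow> bool" where
  "Ck_on k f S \<longleftrightarrow>
     (\<exists>D :: nat \<Rightarrow> real \<Rightarrow> 'a.
        (\<forall>x\<in>S. D 0 x = f x) \<and>
        (\<forall>i<k. \<forall>x\<in>S. (D i has_vector_derivative D (Suc i) x) (at x within S)) \<and>
        continuous_on S (D k))"

definition supp :: "(real \<Rightarrow> 'a::real_normed_vector) \<Rightarrow> real set" where
  "supp g = closure {x. g x \<noteq> 0}"

definition fourier :: "(real \<Rightarrow> complex) \<Rightarrow> real \<Rightarrow> complex" where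
  "fourier g t = (LINT x|lborel. exp (- \<i> * complex_of_real (x * t)) * g x)"

text \<open>In the second branch the value at \<open>0\<close> is \<open>0\<close>, because \<open>0 powr \<gamma> = 0\<close>.\<close>
definition phi :: "real \<Rightarrow> real \<Rightarrow> real" where
  "phi \<gamma> x =
     (if \<exists>m::nat. 0 < m \<and> \<gamma> = 2 * real m then \<bar>x\<bar> powr \<gamma> * ln \<bar>x\<bar> else \<bar>x\<bar> powr \<gamma>)"

text \<open>
  The distributional Fourier transform of \<open>\<phi>\<close>, i.e. the functional sending \<open>\<psi>\<close> to
  \<open>\<integral> \<phi> \<psi>^\<close>, restricted to the punctured line (test functions whose compact support
  avoids \<open>0\<close>), is given by the function \<open>g\<close>.
\<close>
definition gft_coincides_off_0 :: "(real \<Rightarrow> real) \<Rightarrow> (real \<Rightarrow> real) \<Rightarrow> bool" where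
  "gft_coincides_off_0 \<phi> g \<longleftrightarrow>
     (\<forall>\<psi> :: real \<Rightarrow> complex.
        (\<forall>k. Ck_on k \<psi> UNIV) \<and> compact (supp \<psi>) \<and> 0 \<notin> supp \<psi> \<longrightarrow>
        (LINT x|lborel. complex_of_real (\<phi> x) * fourier \<psi> x) =
        (LINT t|lborel. complex_of_real (g t) * \<psi> t))"

text \<open>There is exactly one such constant for each \<open>\<gamma> > 0\<close>, so nothing depends on the choice.\<close>
definition gft_const :: "real \<Rightarrow> real" where
  "gft_const \<gamma> =
     (SOME A. A \<noteq> 0 \<and> gft_coincides_off_0 (phi \<gamma>) (\<lambda>t. A / \<bar>t\<bar> powr (1 + \<gamma>)))"

definition tps_space :: "real \<Rightarrow> nat \<Rightarrow> (real \<Rightarrow> real) set" where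
  "tps_space h n =
     {s. \<exists>(a :: nat \<Rightarrow> real) b0 b1.
        (\<Sum>k=0..n. a k) = 0 \<and> (\<Sum>k=0..n. real k * a k) = 0 \<and>
        (\<forall>x. s x = (\<Sum>k=0..n. a k * phi 2 (x - h * real k)) + b0 + b1 * x)}"

definition tps_interpolant :: "real \<Rightarrow> nat \<Rightarrow> (real \<Rightarrow> real) \<Rightarrow> real \<Rightarrow> real" where
  "tps_interpolant h n f =
     (THE s. s \<in> tps_space h n \<and> (\<forall>i\<in>{0..n}. s (h * real i) = f (h * real i)))"

definition tps_lagrange :: "real \<Rightarrow> nat \<Rightarrow> nat \<Rightarrow> real \<Rightarrow> real" where
  "tps_lagrange h n j =
     (THE l. l \<in> tps_space h n \<and> (\<forall>i\<in>{0..n}. l (real i * h) = (if i = j then 1 else 0)))"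

definition Theta :: "real \<Rightarrow> nat \<Rightarrow> real \<Rightarrow> real \<Rightarrow> complex" where
  "Theta h n x t =
     exp (\<i> * complex_of_real (x * t)) -
     (\<Sum>j=0..n. complex_of_real (tps_lagrange h n j x) * exp (\<i> * complex_of_real (h * real j * t)))"

definition mixed_power :: "real \<Rightarrow> nat \<Rightarrow> real \<Rightarrow> real \<Rightarrow> real" where
  "mixed_power h n \<mu> x =
     sqrt (\<bar>gft_const \<mu>\<bar> / (2 * pi) *
           (LINT t|lborel. (cmod (Theta h n x t))\<^sup>2 / \<bar>t\<bar> powr (1 + \<mu>)))"

definition error_const :: "(real \<Rightarrow> real) \<Rightarrow> real \<Rightarrow> real" where
  "error_const g \<mu> =
     sqrt (1 / (2 * pi * \<bar>gft_const \<mu>\<bar>) *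
           (LINT t|lborel. (cmod (fourier (\<lambda>x. complex_of_real (g x)) t))\<^sup>2 * \<bar>t\<bar> powr (1 + \<mu>)))"

end

theory Submission
  imports Defs "HOL-Probability.Characteristic_Functions" "HOL-Probability.Sinc_Integral"
    "Jordan_Normal_Form.Determinant"
begin

text \<open>
  Fourier inversion turns the error \<open>f(x) - s(x)\<close>, which is \<open>fstar(x) - \<Sum>\<^sub>j fstar(hj) \<ell>\<^sub>j(x)\<close>,
  into \<open>1/(2\<pi>) \<integral> fstar^(t) \<Theta>\<^sub>x(t) dt\<close>, and Cauchy-Schwarz with the weight \<open>|t|\<^sup>1\<^sup>+\<^sup>\<mu>\<close> gives the
  bound; the constant \<open>A\<^sub>\<mu>\<close> cancels, so only \<open>A\<^sub>\<mu> \<noteq> 0\<close> matters.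

  Both \<open>A\<^sub>\<mu> \<noteq> 0\<close> and the unisolvence of thin plate splines come from one formula: the function
  \<open>F(x) = \<integral> (cos(xt) - 1 + [|t| \<le> 1] (xt)\<^sup>2/2) / |t|\<^sup>1\<^sup>+\<^sup>\<gamma> dt\<close> equals \<open>c \<phi>\<^sub>\<gamma>(x) + d x\<^sup>2\<close> by scaling
  (\<open>c = 1\<close> for \<open>\<gamma> = 2\<close>). For coefficients with vanishing moments of order 0 and 1 the quadratic form of
  \<open>c \<phi>\<^sub>\<gamma>\<close> is therefore \<open>\<integral> |\<Sum>\<^sub>j a\<^sub>j exp(i p\<^sub>j t)|\<^sup>2 / |t|\<^sup>1\<^sup>+\<^sup>\<gamma> dt > 0\<close>, which forces \<open>c \<noteq> 0\<close>, and pairing \<open>F\<close>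
  with the transform of a test function gives \<open>A\<^sub>\<gamma> = 2\<pi>/c\<close>.
\<close>

section \<open>Gaussian regularisation and Fourier inversion\<close>

lemma borel_measurable_cis [measurable]: "cis \<in> borel_measurable borel"
  by (intro borel_measurable_continuous_onI continuous_on_cis continuous_on_id)

lemma measurable_cis_compose [measurable (raw)]:
  "f \<in> borel_measurable M \<Longrightarrow> (\<lambda>x. cis (f x)) \<in> borel_measurable M"
  by (rule measurable_compose[OF _ borel_measurable_cis])

lemma fourier_cis: "fourier g t = (LINT x|lborel. cis (- (x * t)) * g x)"
  by (simp add: fourier_def cis_conv_exp)

lemma integrable_cis_mult [intro]:
  fixes g :: "'a \<Rightarrow> complex"
  assumes "integrable M g" and [measurable]: "u \<in> borel_measurable M"
  shows "integrable M (\<lambda>x. cis (u x) * g x)"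
proof (rule Bochner_Integration.integrable_bound[OF assms(1)])
  have [measurable]: "g \<in> borel_measurable M" using assms(1) by simp
  show "(\<lambda>x. cis (u x) * g x) \<in> borel_measurable M" by measurable
qed (simp add: norm_mult)

lemma borel_measurable_fourier [measurable]:
  assumes [measurable]: "g \<in> borel_measurable borel"
  shows "fourier g \<in> borel_measurable borel"
  unfolding fourier_cis[abs_def] by measurable

lemma norm_fourier_le:
  assumes "integrable lborel g"
  shows "cmod (fourier g t) \<le> (LINT x|lborel. cmod (g x))"
proof -
  have "cmod (fourier g t) \<le> (LINT x|lborel. cmod (cis (- (x * t)) * g x))"
    unfolding fourier_cis by (rule integral_norm_bound)
  then show ?thesis by (simp add: norm_mult)
qed

text \<open>By Tonelli the product majorant \<open>u x * v y\<close> is integrable over the plane.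
  The exchanges of integrals below then need only such a pointwise bound.\<close>

lemma integrable_pair_bound:
  fixes F :: "real \<Rightarrow> real \<Rightarrow> complex" and u v :: "real \<Rightarrow> real"
  assumes [measurable]: "case_prod F \<in> borel_measurable (lborel \<Otimes>\<^sub>M lborel)"
    and u: "integrable lborel u" and v: "integrable lborel v"
    and b: "\<And>x y. cmod (F x y) \<le> u x * v y"
  shows "integrable (lborel \<Otimes>\<^sub>M lborel) (case_prod F)"
proof (rule lborel_pair.Fubini_integrable)
  have [measurable]: "u \<in> borel_measurable borel" "v \<in> borel_measurable borel"
    using u v by auto
  have int: "integrable lborel (\<lambda>y. F x y)" for x
    by (rule Bochner_Integration.integrable_bound[OF integrable_mult_right[OF v, of "u x"]])
      (use b[of x] in \<open>auto simp: order_trans[OF _ abs_ge_self]\<close>)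
  then show "AE x in lborel. integrable lborel (\<lambda>y. (case_prod F) (x, y))" by simp
  have "integrable lborel (\<lambda>x. LINT y|lborel. cmod (F x y))"
  proof (rule Bochner_Integration.integrable_bound[OF integrable_mult_left[OF u, of "LINT y|lborel. v y"]])
    show "AE x in lborel. norm (LINT y|lborel. cmod (F x y)) \<le> norm (u x * (LINT y|lborel. v y))"
    proof (rule AE_I2)
      fix x
      have "(LINT y|lborel. cmod (F x y)) \<le> (LINT y|lborel. u x * v y)"
        by (rule integral_mono) (use b int v in auto)
      moreover have "0 \<le> (LINT y|lborel. cmod (F x y))" by simp
      ultimately show "norm (LINT y|lborel. cmod (F x y)) \<le> norm (u x * (LINT y|lborel. v y))"
        by simp
    qed
  qed measurable
  then show "integrable lborel (\<lambda>x. LINT y|lborel. norm ((case_prod F) (x, y)))" by simp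
qed measurable

section \<open>Gaussian summation of Fourier integrals\<close>

lemma integrable_gauss: "integrable lborel (\<lambda>t::real. exp (- (t\<^sup>2) / 2))"
proof -
  have "integrable lborel (\<lambda>t. sqrt (2 * pi) * std_normal_density t)"
    by (intro integrable_mult_right integrable_normal_density) simp
  then show ?thesis unfolding std_normal_density_def by simp
qed

lemma integrable_gauss_scale:
  "\<epsilon> > 0 \<Longrightarrow> integrable lborel (\<lambda>t::real. exp (- (\<epsilon> * t)\<^sup>2 / 2))"
  using lborel_integrable_real_affine[OF integrable_gauss, of \<epsilon> 0] by simp

text \<open>The characteristic function of the standard normal law, read as self-duality of the
  Gaussian and rescaled by \<open>\<epsilon>\<close>.\<close>

lemma integral_cis_gauss:
  assumes "\<epsilon> > 0"
  shows "(LINT t|lborel. cis (w * t) * complex_of_real (exp (- (\<epsilon> * t)\<^sup>2 / 2)))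
       = complex_of_real (2 * pi / \<epsilon> * std_normal_density (w / \<epsilon>))"
proof -
  have "char std_normal_distribution w
      = (LINT x|lborel. std_normal_density x *\<^sub>R cis (w * x))" for w
    unfolding char_def by (subst integral_density) (auto simp: cis_conv_exp normal_density_nonneg)
  then have 0: "(LINT x|lborel. std_normal_density x *\<^sub>R cis (w * x)) = complex_of_real (exp (- (w\<^sup>2) / 2))" for w
    by (simp add: char_std_normal_distribution)
  have d: "2 * pi * std_normal_density w = sqrt (2 * pi) * exp (- (w\<^sup>2) / 2)" for w
  proof -
    have "2 * pi * std_normal_density w = 2 * pi / sqrt (2 * pi) * exp (- (w\<^sup>2) / 2)"
      by (simp add: std_normal_density_def)
    also have "2 * pi / sqrt (2 * pi) = sqrt (2 * pi)"
      by (rule real_div_sqrt) simp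
    finally show ?thesis .
  qed
  have "(LINT x|lborel. cis (w * x) * complex_of_real (exp (- (x)\<^sup>2 / 2))) =
     (LINT x|lborel. complex_of_real (sqrt (2 * pi)) * (std_normal_density x *\<^sub>R cis (w * x)))" for w
    by (rule Bochner_Integration.integral_cong) (auto simp: std_normal_density_def scaleR_conv_of_real real_sqrt_mult)
  then have 1: "(LINT x|lborel. cis (w * x) * complex_of_real (exp (- (x)\<^sup>2 / 2))) =
     complex_of_real (2 * pi * std_normal_density w)" for w
    unfolding integral_mult_right_zero 0 of_real_mult[symmetric] d .
  have "(LINT x|lborel. cis (w / \<epsilon> * x) * complex_of_real (exp (- (x)\<^sup>2 / 2)))
     = \<bar>\<epsilon>\<bar> *\<^sub>R (LINT x|lborel. cis (w * x) * complex_of_real (exp (- (\<epsilon> * x)\<^sup>2 / 2)))"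
    using assms by (subst lborel_integral_real_affine[where c=\<epsilon> and t=0]) auto
  then show ?thesis
    unfolding 1 using assms by (simp add: scaleR_conv_of_real field_simps)
qed

text \<open>After Fubini the inner integral over \<open>t\<close> is a Gaussian of width
  \<open>\<epsilon>\<close> centred at \<open>x\<close>, so the damped inversion integral is a local
  mean of \<open>g\<close>.\<close>

lemma fourier_gauss_inversion:
  fixes g :: "real \<Rightarrow> complex"
  assumes g: "integrable lborel g" and e: "\<epsilon> > 0"
  shows "(LINT t|lborel. fourier g t * cis (x * t) * complex_of_real (exp (- (\<epsilon> * t)\<^sup>2 / 2)))
    = 2 * pi * (LINT z|lborel. std_normal_density z *\<^sub>R g (x + \<epsilon> * z))"
proof -
  have [measurable]: "g \<in> borel_measurable borel" using g by simp
  define F where "F t y = cis (- (y * t)) * g y * cis (x * t) * complex_of_real (exp (- (\<epsilon> * t)\<^sup>2 / 2))" for t y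
  have intF: "integrable (lborel \<Otimes>\<^sub>M lborel) (case_prod F)"
  proof (rule integrable_pair_bound[OF _ integrable_gauss_scale[OF e] integrable_norm[OF g]])
    show "case_prod F \<in> borel_measurable (lborel \<Otimes>\<^sub>M lborel)"
      unfolding F_def by measurable
  qed (simp add: F_def norm_mult)
  have "(LINT t|lborel. fourier g t * cis (x * t) * complex_of_real (exp (- (\<epsilon> * t)\<^sup>2 / 2)))
     = (LINT t|lborel. LINT y|lborel. F t y)"
    unfolding fourier_cis F_def by simp
  also have "\<dots> = (LINT y|lborel. LINT t|lborel. F t y)"
    using lborel_pair.Fubini_integral[OF intF] by simp
  also have "\<dots> = (LINT y|lborel. g y * complex_of_real (2 * pi / \<epsilon> * std_normal_density ((x - y) / \<epsilon>)))"
  proof (rule Bochner_Integration.integral_cong[OF refl])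
    fix y
    have "F t y = g y * (cis ((x - y) * t) * complex_of_real (exp (- (\<epsilon> * t)\<^sup>2 / 2)))" for t
    proof -
      have "cis ((x - y) * t) = cis (- (y * t)) * cis (x * t)"
        by (simp add: cis_mult algebra_simps)
      then show ?thesis unfolding F_def by (simp add: mult_ac)
    qed
    then show "(LINT t|lborel. F t y) = g y * complex_of_real (2 * pi / \<epsilon> * std_normal_density ((x - y) / \<epsilon>))"
      using integral_cis_gauss[OF e, of "x - y"] by simp
  qed
  \<comment> \<open>Substitution \<open>y = x + \<epsilon> * z\<close>; its Jacobian cancels the
    \<open>1 / \<epsilon>\<close> of the kernel.\<close>
  also have "\<dots> = \<epsilon> *\<^sub>R (LINT z|lborel. g (x + \<epsilon> * z) * complex_of_real (2 * pi / \<epsilon> * std_normal_density (- z)))"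
    using e by (subst lborel_integral_real_affine[where c=\<epsilon> and t=x]) auto
  also have "\<dots> = \<epsilon> *\<^sub>R (LINT z|lborel. (2 * pi / \<epsilon>) * (std_normal_density z *\<^sub>R g (x + \<epsilon> * z)))"
    by (auto intro!: Bochner_Integration.integral_cong simp: std_normal_density_def scaleR_conv_of_real mult_ac)
  also have "\<dots> = 2 * pi * (LINT z|lborel. std_normal_density z *\<^sub>R g (x + \<epsilon> * z))"
    using e by (simp add: scaleR_conv_of_real)
  finally show ?thesis .
qed

lemma gauss_scale_tendsto:
  "(\<lambda>k. exp (- (inverse (real (Suc k)) * t)\<^sup>2 / 2)) \<longlonglongrightarrow> 1"
proof -
  have "(\<lambda>k. exp (- (inverse (real (Suc k)) * t)\<^sup>2 / 2)) \<longlonglongrightarrow> exp (- (0 * t)\<^sup>2 / 2)"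
    by (intro tendsto_intros LIMSEQ_inverse_real_of_nat) auto
  then show ?thesis by simp
qed

text \<open>Let the width \<open>1 / (k + 1)\<close> tend to 0 in
  \<open>fourier_gauss_inversion\<close>: the damped integral is dominated by
  \<open>cmod (fourier g t)\<close>, the local mean by \<open>B\<close> times the normal
  density.\<close>

theorem fourier_inversion:
  fixes g :: "real \<Rightarrow> complex"
  assumes g: "integrable lborel g" and cont: "continuous_on UNIV g"
    and B: "\<And>x. cmod (g x) \<le> B" and gh: "integrable lborel (fourier g)"
  shows "(LINT t|lborel. fourier g t * cis (x * t)) = 2 * pi * g x"
proof -
  have [measurable]: "g \<in> borel_measurable borel" using g by simp
  let ?e = "\<lambda>k. inverse (real (Suc k))"
  have "(\<lambda>k. LINT t|lborel. fourier g t * cis (x * t) * complex_of_real (exp (- (?e k * t)\<^sup>2 / 2)))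
      \<longlonglongrightarrow> (LINT t|lborel. fourier g t * cis (x * t))"
  proof (rule integral_dominated_convergence[where w="\<lambda>t. cmod (fourier g t)"])
    show "AE t in lborel. (\<lambda>k. fourier g t * cis (x * t) * complex_of_real (exp (- (?e k * t)\<^sup>2 / 2)))
        \<longlonglongrightarrow> fourier g t * cis (x * t)"
    proof (rule AE_I2)
      fix t
      have "(\<lambda>k. fourier g t * cis (x * t) * complex_of_real (exp (- (?e k * t)\<^sup>2 / 2)))
        \<longlonglongrightarrow> fourier g t * cis (x * t) * complex_of_real 1"
        by (intro tendsto_intros gauss_scale_tendsto)
      then show "(\<lambda>k. fourier g t * cis (x * t) * complex_of_real (exp (- (?e k * t)\<^sup>2 / 2)))
        \<longlonglongrightarrow> fourier g t * cis (x * t)" by simp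
    qed
    show "AE t in lborel. cmod (fourier g t * cis (x * t) * complex_of_real (exp (- (?e k * t)\<^sup>2 / 2)))
       \<le> cmod (fourier g t)" for k
      by (rule AE_I2) (auto simp: norm_mult intro!: mult_left_le)
  qed (use gh in auto)
  moreover have "(\<lambda>k. 2 * pi * (LINT z|lborel. std_normal_density z *\<^sub>R g (x + ?e k * z)))
      \<longlonglongrightarrow> 2 * pi * (LINT z|lborel. std_normal_density z *\<^sub>R g x)"
  proof (intro tendsto_intros integral_dominated_convergence[where w="\<lambda>z. std_normal_density z * B"])
    show "integrable lborel (\<lambda>z. std_normal_density z * B)"
      by (intro integrable_mult_left integrable_normal_density) simp
    show "AE z in lborel. (\<lambda>k. std_normal_density z *\<^sub>R g (x + ?e k * z)) \<longlonglongrightarrow> std_normal_density z *\<^sub>R g x"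
    proof (rule AE_I2)
      fix z
      have "(\<lambda>k. x + ?e k * z) \<longlonglongrightarrow> x + 0 * z"
        by (intro tendsto_intros LIMSEQ_inverse_real_of_nat)
      then have "(\<lambda>k. g (x + ?e k * z)) \<longlonglongrightarrow> g x"
        using cont by (intro isCont_tendsto_compose[of x g]) (auto simp: continuous_on_eq_continuous_at)
      then show "(\<lambda>k. std_normal_density z *\<^sub>R g (x + ?e k * z)) \<longlonglongrightarrow> std_normal_density z *\<^sub>R g x"
        by (intro tendsto_intros)
    qed
    show "AE z in lborel. norm (std_normal_density z *\<^sub>R g (x + ?e k * z)) \<le> std_normal_density z * B" for k
      by (rule AE_I2) (auto intro!: mult_left_mono B)
  qed measurable
  moreover have "(LINT z|lborel. std_normal_density z *\<^sub>R g x) = g x"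
    by (subst integral_scaleR_left) (auto intro!: integrable_normal_density simp: integral_normal_density)
  ultimately show ?thesis
    using fourier_gauss_inversion[OF g, of "?e _" x]
    by (simp add: LIMSEQ_unique)
qed

lemma borel_measurable_cnj [measurable (raw)]:
  "f \<in> borel_measurable M \<Longrightarrow> (\<lambda>x. cnj (f x)) \<in> borel_measurable M"
  by (rule measurable_compose[of f])
    (auto intro!: borel_measurable_continuous_onI continuous_intros)

lemma cnj_fourier: "cnj (fourier g t) = (LINT x|lborel. cis (x * t) * cnj (g x))"
  unfolding fourier_cis Bochner_Integration.integral_cnj[symmetric] by (simp add: cis_cnj)

text \<open>The Gaussian means of \<open>|fourier g|\<^sup>2\<close> are bounded by \<open>2 \<pi> \<parallel>g\<parallel>\<^sub>1 \<parallel>g\<parallel>\<^sub>\<infinity>\<close>;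
  this replaces Plancherel's theorem.\<close>
lemma integrable_fourier_square:
  fixes g :: "real \<Rightarrow> complex"
  assumes g: "integrable lborel g" and B: "\<And>x. cmod (g x) \<le> B"
  shows "integrable lborel (\<lambda>t. (cmod (fourier g t))\<^sup>2)"
proof -
  have [measurable]: "g \<in> borel_measurable borel" using g by simp
  let ?e = "\<lambda>k. inverse (real (Suc k))"
  let ?w = "\<lambda>k t. exp (- (?e k * t)\<^sup>2 / 2)"
  let ?N = "LINT x|lborel. cmod (g x)"
  have N0: "?N \<ge> 0" and B0: "B \<ge> 0" using order_trans[OF norm_ge_zero B] by auto
  have bound: "(LINT t|lborel. (cmod (fourier g t))\<^sup>2 * ?w k t) \<le> 2 * pi * B * ?N" for k
  proof -
    \<comment> \<open>The squared modulus is \<open>fourier g t\<close> times its conjugate. Writing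
      the conjugate as an integral over \<open>x\<close> turns the integral over \<open>t\<close>
      into a damped inversion integral.\<close>
    define F where "F t x = fourier g t * complex_of_real (?w k t) * (cis (x * t) * cnj (g x))" for t x
    have intF: "integrable (lborel \<Otimes>\<^sub>M lborel) (case_prod F)"
    proof (rule integrable_pair_bound[OF _ integrable_mult_right[OF integrable_gauss_scale] integrable_norm[OF g]])
      show "case_prod F \<in> borel_measurable (lborel \<Otimes>\<^sub>M lborel)"
        unfolding F_def by measurable
      show "?e k > 0" by simp
      show "cmod (F t x) \<le> ?N * ?w k t * cmod (g x)" for t x
        unfolding F_def using norm_fourier_le[OF g, of t] by (auto simp: norm_mult intro!: mult_right_mono)
    qed
    have "complex_of_real (LINT t|lborel. (cmod (fourier g t))\<^sup>2 * ?w k t)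
       = (LINT t|lborel. fourier g t * complex_of_real (?w k t) * cnj (fourier g t))"
      unfolding integral_complex_of_real[symmetric]
      by (rule Bochner_Integration.integral_cong) (simp_all add: complex_norm_square[simplified of_real_power] mult_ac)
    also have "\<dots> = (LINT t|lborel. LINT x|lborel. F t x)"
      unfolding F_def cnj_fourier by simp
    also have "\<dots> = (LINT x|lborel. LINT t|lborel. F t x)"
      using lborel_pair.Fubini_integral[OF intF] by simp
    also have "\<dots> = (LINT x|lborel. cnj (g x) * (LINT t|lborel. fourier g t * cis (x * t) * complex_of_real (?w k t)))"
      unfolding F_def by (subst integral_mult_right_zero[symmetric]) (simp add: mult_ac)
    finally have eq: "complex_of_real (LINT t|lborel. (cmod (fourier g t))\<^sup>2 * ?w k t) = \<dots>" .
    \<comment> \<open>Up to the factor \<open>2 * pi\<close> this is a mean of \<open>g\<close>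
      against a probability density, hence bounded by \<open>B\<close>.\<close>
    have inner: "cmod (LINT t|lborel. fourier g t * cis (x * t) * complex_of_real (?w k t)) \<le> 2 * pi * B" for x
    proof -
      have "cmod (LINT z|lborel. std_normal_density z *\<^sub>R g (x + ?e k * z))
         \<le> (LINT z|lborel. std_normal_density z * B)"
      proof (rule order_trans[OF integral_norm_bound], rule integral_mono_AE')
        show "integrable lborel (\<lambda>z. std_normal_density z * B)"
          by (intro integrable_mult_left integrable_normal_density) simp
      qed (use B0 in \<open>auto intro!: mult_left_mono B\<close>)
      also have "\<dots> = B" by simp
      finally show ?thesis
        by (subst fourier_gauss_inversion[OF g]) (auto simp: norm_mult)
    qed
    have "\<bar>LINT t|lborel. (cmod (fourier g t))\<^sup>2 * ?w k t\<bar>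
       = cmod (LINT x|lborel. cnj (g x) * (LINT t|lborel. fourier g t * cis (x * t) * complex_of_real (?w k t)))"
      unfolding eq[symmetric] by simp
    also have "\<dots> \<le> (LINT x|lborel. cmod (g x) * (2 * pi * B))"
    proof (rule order_trans[OF integral_norm_bound], rule integral_mono_AE')
      show "integrable lborel (\<lambda>x. cmod (g x) * (2 * pi * B))"
        using g by (intro integrable_mult_left integrable_norm)
      show "AE x in lborel. cmod (cnj (g x) * (LINT t|lborel. fourier g t * cis (x * t) * complex_of_real (?w k t)))
          \<le> cmod (g x) * (2 * pi * B)"
        unfolding norm_mult complex_mod_cnj by (intro AE_I2 mult_left_mono inner) simp
    qed (use B0 in auto)
    also have "\<dots> = 2 * pi * B * ?N" by simp
    finally show ?thesis by linarith
  qed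
  have int: "integrable lborel (\<lambda>t. (cmod (fourier g t))\<^sup>2 * ?w k t)" for k
  proof (rule Bochner_Integration.integrable_bound[OF integrable_mult_right[OF integrable_gauss_scale[of "?e k"], of "?N\<^sup>2"]])
    show "AE t in lborel. norm ((cmod (fourier g t))\<^sup>2 * ?w k t) \<le> norm (?N\<^sup>2 * ?w k t)"
      using norm_fourier_le[OF g] by (auto intro!: mult_right_mono power_mono)
  qed auto
  \<comment> \<open>The damping weakens as \<open>k\<close> grows, so the bounded integrals allow
    monotone convergence.\<close>
  have mono: "?w k t \<le> ?w l t" if "k \<le> l" for k l t
  proof -
    have "(?e l)\<^sup>2 * t\<^sup>2 \<le> (?e k)\<^sup>2 * t\<^sup>2"
      using that by (intro mult_right_mono power_mono le_imp_inverse_le) auto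
    then show ?thesis by (simp only: exp_le_cancel_iff power_mult_distrib)
  qed
  have "incseq (\<lambda>k. LINT t|lborel. (cmod (fourier g t))\<^sup>2 * ?w k t)"
  proof (rule incseq_SucI)
    fix k
    show "(LINT t|lborel. (cmod (fourier g t))\<^sup>2 * ?w k t) \<le> (LINT t|lborel. (cmod (fourier g t))\<^sup>2 * ?w (Suc k) t)"
    proof (rule integral_mono[OF int int])
      show "(cmod (fourier g t))\<^sup>2 * ?w k t \<le> (cmod (fourier g t))\<^sup>2 * ?w (Suc k) t" for t
        by (rule mult_left_mono[OF mono]) simp_all
    qed
  qed
  moreover have "\<forall>k. (LINT t|lborel. (cmod (fourier g t))\<^sup>2 * ?w k t) \<le> 2 * pi * B * ?N"
    using bound by blast
  ultimately obtain L where L: "(\<lambda>k. LINT t|lborel. (cmod (fourier g t))\<^sup>2 * ?w k t) \<longlonglongrightarrow> L"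
    by (rule incseq_convergent)
  show ?thesis
  proof (rule integral_monotone_convergence_nonneg(1)[OF int _ _ _ L])
    show "AE t in lborel. mono (\<lambda>k. (cmod (fourier g t))\<^sup>2 * ?w k t)"
    proof (intro AE_I2 monoI)
      show "(cmod (fourier g t))\<^sup>2 * ?w k t \<le> (cmod (fourier g t))\<^sup>2 * ?w l t" if "k \<le> l" for k l t
        by (rule mult_left_mono[OF mono[OF that]]) simp
    qed
    show "AE t in lborel. (\<lambda>k. (cmod (fourier g t))\<^sup>2 * ?w k t) \<longlonglongrightarrow> (cmod (fourier g t))\<^sup>2"
    proof (rule AE_I2)
      fix t
      have "(\<lambda>k. (cmod (fourier g t))\<^sup>2 * ?w k t) \<longlonglongrightarrow> (cmod (fourier g t))\<^sup>2 * 1"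
        by (intro tendsto_intros gauss_scale_tendsto)
      then show "(\<lambda>k. (cmod (fourier g t))\<^sup>2 * ?w k t) \<longlonglongrightarrow> (cmod (fourier g t))\<^sup>2" by simp
    qed
  qed auto
qed

section \<open>Compactly supported differentiable functions and the decay of their
  transforms\<close>

definition is_Ck_chain :: "nat \<Rightarrow> (nat \<Rightarrow> real \<Rightarrow> complex) \<Rightarrow> real \<Rightarrow> bool" where
  "is_Ck_chain k D R \<longleftrightarrow>
     (\<forall>i<k. \<forall>x. (D i has_vector_derivative D (Suc i) x) (at x)) \<and>
     (\<forall>i\<le>k. continuous_on UNIV (D i)) \<and>
     (\<forall>i\<le>k. \<forall>x. R < \<bar>x\<bar> \<longrightarrow> D i x = 0)"

lemma zero_outside_supp: "x \<notin> supp g \<Longrightarrow> g x = 0"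
  unfolding supp_def using closure_subset[of "{x. g x \<noteq> 0}"] by auto

text \<open>Vanishing off \<open>supp g\<close> passes from each derivative to the next because the
  complement of the support is open. For a test function whose support avoids 0 this makes the
  second derivative vanish at 0.\<close>

lemma Ck_on_compact_supp_chain:
  fixes g :: "real \<Rightarrow> complex"
  assumes "Ck_on k g UNIV" "compact (supp g)"
  obtains D R where "D 0 = g" "is_Ck_chain k D R"
    "\<And>i x. i \<le> k \<Longrightarrow> x \<notin> supp g \<Longrightarrow> D i x = 0"
proof -
  obtain D where D0: "\<And>x. D 0 x = g x"
    and der: "\<And>i x. i < k \<Longrightarrow> (D i has_vector_derivative D (Suc i) x) (at x)"
    and ck: "continuous_on UNIV (D k)"
    using assms(1) unfolding Ck_on_def by auto
  have cont: "continuous_on UNIV (D i)" if "i \<le> k" for i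
  proof (cases "i = k")
    case False
    then show ?thesis using der[of i] that
      by (auto intro!: continuous_at_imp_continuous_on has_vector_derivative_continuous)
  qed (use ck in simp)
  have zero: "\<forall>x. x \<notin> supp g \<longrightarrow> D i x = 0" if "i \<le> k" for i
    using that
  proof (induction i)
    case 0
    then show ?case by (simp add: D0 zero_outside_supp)
  next
    case (Suc i)
    show ?case
    proof (intro allI impI)
      fix x assume x: "x \<notin> supp g"
      have op: "open (- supp g)" unfolding supp_def by auto
      have "((\<lambda>_. 0) has_vector_derivative D (Suc i) x) (at x)"
      proof (rule has_vector_derivative_transform_within_open[OF _ op])
        show "(D i has_vector_derivative D (Suc i) x) (at x)" using der Suc by simp
        show "D i y = 0" if "y \<in> - supp g" for y using that Suc by simp
      qed (use x in simp)
      then show "D (Suc i) x = 0"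
        using vector_derivative_unique_at has_vector_derivative_const by blast
    qed
  qed
  obtain R where "\<And>x. x \<in> supp g \<Longrightarrow> norm x \<le> R"
    using compact_imp_bounded[OF assms(2)] unfolding bounded_iff by blast
  then have R: "x \<notin> supp g" if "R < \<bar>x\<bar>" for x using that by force
  show thesis
    by (rule that[of D R]) (use D0 der cont zero R in \<open>auto simp: is_Ck_chain_def\<close>)
qed

lemma integrable_continuous_compact_supp:
  fixes g :: "real \<Rightarrow> complex"
  assumes "continuous_on UNIV g" "\<And>x. R < \<bar>x\<bar> \<Longrightarrow> g x = 0"
  shows "integrable lborel g"
proof -
  have "set_integrable lborel {-R..R} g"
    unfolding set_integrable_def
    by (rule borel_integrable_compact) (auto intro: continuous_on_subset[OF assms(1)])
  moreover have "(\<lambda>x. indicator {-R..R} x *\<^sub>R g x) = g"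
    using assms(2) by (force simp: indicator_def not_le abs_le_iff)
  ultimately show ?thesis by (simp add: set_integrable_def)
qed

lemma bounded_continuous_compact_supp:
  fixes g :: "real \<Rightarrow> complex"
  assumes "continuous_on UNIV g" "\<And>x. R < \<bar>x\<bar> \<Longrightarrow> g x = 0"
  obtains B where "\<And>x. cmod (g x) \<le> B"
proof -
  have "bounded (g ` {-R..R})"
    by (intro compact_imp_bounded compact_continuous_image continuous_on_subset[OF assms(1)]) auto
  then obtain B where B: "\<And>x. x \<in> {-R..R} \<Longrightarrow> cmod (g x) \<le> B"
    unfolding bounded_iff by blast
  have "cmod (g x) \<le> max B 0" for x
  proof (cases "R < \<bar>x\<bar>")
    case False
    then have "x \<in> {-R..R}" by auto
    then show ?thesis using B[of x] by simp
  qed (simp add: assms(2))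
  then show ?thesis using that by blast
qed

text \<open>Integration by parts: the derivative of \<open>cis (- (x * t)) * g x\<close> integrates
  to zero, since \<open>g\<close> vanishes at the end points.\<close>

lemma fourier_deriv:
  fixes g :: "real \<Rightarrow> complex"
  assumes der: "\<And>x. (g has_vector_derivative g' x) (at x)"
    and cont: "continuous_on UNIV g'"
    and z: "\<And>x. R < \<bar>x\<bar> \<Longrightarrow> g x = 0" and z': "\<And>x. R < \<bar>x\<bar> \<Longrightarrow> g' x = 0"
  shows "fourier g' t = \<i> * t * fourier g t"
proof -
  have cg: "continuous_on UNIV g"
    using der by (auto intro!: continuous_at_imp_continuous_on has_vector_derivative_continuous)
  note ig = integrable_continuous_compact_supp[OF cg z] and ig' = integrable_continuous_compact_supp[OF cont z']
  let ?F = "\<lambda>x. cis (- (x * t)) * g x"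
  let ?f = "\<lambda>x. cis (- (x * t)) * g' x - \<i> * t * (cis (- (x * t)) * g x)"
  have "((\<lambda>x. cis (- (x * t))) has_vector_derivative - \<i> * t * cis (- (x * t))) (at x)" for x
    unfolding has_vector_derivative_def
    by (auto intro!: derivative_eq_intros simp: scaleR_conv_of_real)
  then have F: "(?F has_vector_derivative ?f x) (at x)" for x
    by (rule has_vector_derivative_eq_rhs[OF has_vector_derivative_mult[OF _ der]]) auto
  \<comment> \<open>\<open>S\<close> is positive and exceeds \<open>R\<close> even if
    \<open>R\<close> is negative, so \<open>g\<close> vanishes at both end points and
    \<open>g\<close>, \<open>g'\<close> vanish outside the interval.\<close>
  define S where "S = \<bar>R\<bar> + 1"
  have "(LINT x|lborel. indicator {-S..S} x *\<^sub>R ?f x) = ?F S - ?F (-S)"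
  proof (rule integral_FTC_Icc)
    show "continuous_on {-S..S} ?f"
      unfolding cis_conv_exp
      by (intro continuous_intros continuous_on_subset[OF cont] continuous_on_subset[OF cg]) auto
  qed (auto simp: S_def intro: has_vector_derivative_at_within[OF F])
  also have "\<dots> = 0" using z[of S] z[of "-S"] by (simp add: S_def)
  also have "(\<lambda>x. indicator {-S..S} x *\<^sub>R ?f x) = ?f"
  proof (rule ext)
    fix x
    show "indicator {-S..S} x *\<^sub>R ?f x = ?f x"
    proof (cases "R < \<bar>x\<bar>")
      case False
      then have "x \<in> {-S..S}" by (auto simp: S_def)
      then show ?thesis by simp
    qed (simp add: z z')
  qed
  finally have "(LINT x|lborel. ?f x) = 0" .
  then show ?thesis
    unfolding fourier_cis using ig ig'
    by (subst (asm) Bochner_Integration.integral_diff) (auto intro!: integrable_mult_right)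
qed

context
  fixes k D R
  assumes D: "is_Ck_chain k D R"
begin

lemma chain_integrable: "i \<le> k \<Longrightarrow> integrable lborel (D i)"
  using D by (intro integrable_continuous_compact_supp[where R=R]) (auto simp: is_Ck_chain_def)

lemma chain_bounded:
  assumes "i \<le> k"
  obtains B where "\<And>x. cmod (D i x) \<le> B"
proof (rule bounded_continuous_compact_supp)
  show "continuous_on UNIV (D i)" using D assms by (simp add: is_Ck_chain_def)
  show "D i x = 0" if "R < \<bar>x\<bar>" for x using D assms that by (simp add: is_Ck_chain_def)
qed (rule that)

lemma fourier_chain: "i \<le> k \<Longrightarrow> fourier (D i) t = (\<i> * t) ^ i * fourier (D 0) t"
proof (induction i)
  case (Suc i)
  have "fourier (D (Suc i)) t = \<i> * t * fourier (D i) t"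
    using D Suc.prems by (intro fourier_deriv[where R=R]) (auto simp: is_Ck_chain_def)
  then show ?case using Suc by simp
qed simp

text \<open>The transforms of \<open>D 0\<close> and \<open>D k\<close> are bounded by L1 norms, and
  the second is \<open>(\<i> * t) ^ k\<close> times the first.\<close>

lemma fourier_decay:
  obtains C where "\<And>t. (1 + \<bar>t\<bar> ^ k) * cmod (fourier (D 0) t) \<le> C"
proof -
  have "(1 + \<bar>t\<bar> ^ k) * cmod (fourier (D 0) t)
      \<le> (LINT x|lborel. cmod (D 0 x)) + (LINT x|lborel. cmod (D k x))" for t
    using norm_fourier_le[OF chain_integrable[of 0], of t] norm_fourier_le[OF chain_integrable[of k], of t]
    by (simp add: fourier_chain[of k] norm_mult norm_power algebra_simps)
  then show ?thesis using that by blast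
qed

text \<open>In modulus \<open>t ^ i * fourier (D 0) t\<close> is the transform of the bounded
  integrable function \<open>D i\<close>. Pointwise decay would not do for
  \<open>error_const\<close>: when \<open>\<mu> / 2 + 1\<close> is an integer it bounds the
  integrand only by a multiple of \<open>1 / |t|\<close>.\<close>

lemma integrable_fourier_chain_square: "i \<le> k \<Longrightarrow> integrable lborel (\<lambda>t. \<bar>t\<bar> ^ (2 * i) * (cmod (fourier (D 0) t))\<^sup>2)"
proof -
  assume i: "i \<le> k"
  obtain B where "\<And>x. cmod (D i x) \<le> B" using chain_bounded[OF i] by blast
  then have "integrable lborel (\<lambda>t. (cmod (fourier (D i) t))\<^sup>2)"
    using integrable_fourier_square chain_integrable[OF i] by blast
  moreover have "(cmod (fourier (D i) t))\<^sup>2 = \<bar>t\<bar> ^ (2 * i) * (cmod (fourier (D 0) t))\<^sup>2" for t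
    unfolding fourier_chain[OF i] norm_mult norm_power power_mult_distrib power_even_eq by simp
  ultimately show ?thesis by simp
qed

end

lemma lborel_integrable_inverse_1_plus_square: "integrable lborel (\<lambda>t::real. 1 / (1 + t\<^sup>2))"
  using integrable_inverse_1_plus_square
  by (simp add: set_integrable_def inverse_eq_divide)

text \<open>Two derivatives beyond order \<open>m\<close> provide the integrable majorant
  \<open>1 / (1 + t\<^sup>2)\<close>.\<close>

lemma integrable_fourier_chain:
  fixes D :: "nat \<Rightarrow> real \<Rightarrow> complex"
  assumes "is_Ck_chain k D R" "m + 2 \<le> k"
  shows "integrable lborel (\<lambda>t. \<bar>t\<bar> ^ m * cmod (fourier (D 0) t))"
proof -
  have D0: "integrable lborel (D 0)" using chain_integrable[OF assms(1)] by simp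
  then have [measurable]: "D 0 \<in> borel_measurable borel" by simp
  obtain C where C: "\<And>t. (1 + \<bar>t\<bar> ^ k) * cmod (fourier (D 0) t) \<le> C"
    using fourier_decay[OF assms(1)] by blast
  have C0: "C \<ge> 0" using order_trans[OF _ C[of 0]] by (simp add: zero_le_mult_iff)
  show ?thesis
  proof (rule Bochner_Integration.integrable_bound[OF integrable_mult_right[OF lborel_integrable_inverse_1_plus_square, of "3 * C"]])
    show "AE t in lborel. norm (\<bar>t\<bar> ^ m * cmod (fourier (D 0) t)) \<le> norm (3 * C * (1 / (1 + t\<^sup>2)))"
    proof (rule AE_I2)
      fix t :: real
      have p: "\<bar>t\<bar> ^ j \<le> 1 + \<bar>t\<bar> ^ k" if "j \<le> k" for j
      proof (cases "\<bar>t\<bar> \<le> 1")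
        case True then show ?thesis using power_le_one[of "\<bar>t\<bar>" j] by (simp add: add_increasing2)
      next
        case False then show ?thesis using power_increasing[OF that, of "\<bar>t\<bar>"] by linarith
      qed
      have "(1 + t\<^sup>2) * \<bar>t\<bar> ^ m = \<bar>t\<bar> ^ m + \<bar>t\<bar> ^ (m + 2)"
        by (simp add: algebra_simps power_add power2_eq_square)
      also have "\<dots> \<le> 3 * (1 + \<bar>t\<bar> ^ k)"
      proof -
        have "u + v \<le> 3 * (1 + w)" if "u \<le> 1 + w" "v \<le> 1 + w" "0 \<le> w" for u v w :: real
          using that by simp
        then show ?thesis
          using p[OF add_leD1[OF assms(2)]] p[OF assms(2)] by (simp only: zero_le_power abs_ge_zero)
      qed
      finally have "(1 + t\<^sup>2) * \<bar>t\<bar> ^ m * cmod (fourier (D 0) t) \<le> 3 * (1 + \<bar>t\<bar> ^ k) * cmod (fourier (D 0) t)"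
        by (rule mult_right_mono) simp
      also have "\<dots> \<le> 3 * C" unfolding mult.assoc using C[of t] by (rule mult_left_mono) simp
      finally have "(1 + t\<^sup>2) * (\<bar>t\<bar> ^ m * cmod (fourier (D 0) t)) \<le> 3 * C" by (simp add: mult.assoc)
      moreover have "1 + t\<^sup>2 > 0" by (simp add: add_pos_nonneg)
      ultimately show "norm (\<bar>t\<bar> ^ m * cmod (fourier (D 0) t)) \<le> norm (3 * C * (1 / (1 + t\<^sup>2)))"
        using C0 by (simp add: field_simps abs_mult)
    qed
  qed measurable
qed

text \<open>Used with \<open>m = 0\<close> to recover function values and with \<open>m = 2\<close>
  to recover the second derivative at 0.\<close>

corollary fourier_inversion_chain:
  fixes D :: "nat \<Rightarrow> real \<Rightarrow> complex"
  assumes "is_Ck_chain k D R" "m + 2 \<le> k"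
  shows "(LINT t|lborel. (\<i> * t) ^ m * fourier (D 0) t * cis (x * t)) = 2 * pi * D m x"
proof -
  obtain B where "\<And>x. cmod (D m x) \<le> B" using chain_bounded[OF assms(1), of m] assms(2) by (metis add_leD1)
  moreover have i: "integrable lborel (D m)" using chain_integrable[OF assms(1)] assms(2) by simp
  moreover have "continuous_on UNIV (D m)" using assms by (auto simp: is_Ck_chain_def)
  moreover have "integrable lborel (fourier (D m))"
  proof (rule Bochner_Integration.integrable_bound[OF integrable_fourier_chain[OF assms]])
    have [measurable]: "D m \<in> borel_measurable borel" using i by simp
    show "fourier (D m) \<in> borel_measurable lborel" by measurable
  qed (use fourier_chain[OF assms(1), of m] assms(2) in \<open>auto simp: norm_mult norm_power\<close>)
  ultimately have "(LINT t|lborel. fourier (D m) t * cis (x * t)) = 2 * pi * D m x"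
    by (intro fourier_inversion)
  then show ?thesis using fourier_chain[OF assms(1), of m] assms(2) by simp
qed

section \<open>The generalised Fourier transform of the radial function\<close>

lemma has_bochner_integral_reflect:
  fixes f :: "real \<Rightarrow> 'a::{banach, second_countable_topology}"
  assumes "has_bochner_integral lborel f I"
  shows "has_bochner_integral lborel (\<lambda>x. f (- x)) I"
  using lborel_has_bochner_integral_real_affine_iff[of "-1" f I 0] assms by simp

lemma integrable_even_powr:
  assumes "(\<lambda>x. x powr a) integrable_on S" and S: "S \<in> sets borel" "S \<subseteq> {0<..}"
  shows "integrable lborel (\<lambda>x::real. indicator S \<bar>x\<bar> * \<bar>x\<bar> powr a)"
proof -
  have [measurable]: "S \<in> sets borel" by (rule S)
  have "(\<lambda>x. x powr a) absolutely_integrable_on S"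
    by (rule nonnegative_absolutely_integrable_1[OF assms(1)]) simp
  then have i: "integrable lborel (\<lambda>x. indicator S x * x powr a)"
    unfolding set_integrable_def by (subst (asm) integrable_completion) auto
  then have "integrable lborel (\<lambda>x. indicator S x * x powr a + indicator S (-x) * (-x) powr a)"
    using has_bochner_integral_reflect[OF has_bochner_integral_integrable[OF i]]
    by (auto simp: has_bochner_integral_iff)
  moreover have "indicator S x * x powr a + indicator S (-x) * (-x) powr a = indicator S \<bar>x\<bar> * \<bar>x\<bar> powr a" for x :: real
    using S(2) by (cases "x > 0"; cases "x < 0") (auto simp: indicator_def)
  ultimately show ?thesis by simp
qed

text \<open>Profile of the majorant of \<open>cos_kernel\<close>: near 0 the fourth-order cosine
  remainder leaves the power \<open>4 - (1 + \<gamma>)\<close> of \<open>|t|\<close>, far out only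
  the weight remains. It is integrable at 0 because \<open>\<gamma> < 4\<close> and at infinity
  because \<open>0 < \<gamma>\<close>.\<close>

definition tail_weight :: "real \<Rightarrow> real \<Rightarrow> real" where
  "tail_weight \<gamma> t = (if \<bar>t\<bar> \<le> 1 then \<bar>t\<bar> powr (3 - \<gamma>) else \<bar>t\<bar> powr (- (1 + \<gamma>)))"

lemma integrable_tail_weight:
  assumes "0 < \<gamma>" "\<gamma> < 4"
  shows "integrable lborel (tail_weight \<gamma>)"
proof -
  have "integrable lborel (\<lambda>t. indicator {0<..1} \<bar>t\<bar> * \<bar>t\<bar> powr (3 - \<gamma>))"
    by (rule integrable_even_powr, rule integrable_on_powr_from_0') (use assms in auto)
  moreover have "integrable lborel (\<lambda>t. indicator {1<..} \<bar>t\<bar> * \<bar>t\<bar> powr (- (1 + \<gamma>)))"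
  proof (rule integrable_even_powr)
    have "(\<lambda>x. x powr (- (1 + \<gamma>))) integrable_on {1..}"
      using has_integral_powr_to_inf[of "- (1 + \<gamma>)" 1] assms unfolding integrable_on_def by auto
    moreover have "negligible {x. x \<in> {1..} - {1<..} \<and> x powr (- (1 + \<gamma>)) \<noteq> 0}"
      by (rule negligible_subset[of "{1}"]) auto
    moreover have "negligible {x. x \<in> {1<..} - {1..} \<and> x powr (- (1 + \<gamma>)) \<noteq> 0}"
      by (rule negligible_subset[of "{1}"]) auto
    ultimately show "(\<lambda>x. x powr (- (1 + \<gamma>))) integrable_on {1<..}"
      by (rule integrable_spike_set)
  qed auto
  ultimately have "integrable lborel (\<lambda>t. indicator {0<..1} \<bar>t\<bar> * \<bar>t\<bar> powr (3 - \<gamma>)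
      + indicator {1<..} \<bar>t\<bar> * \<bar>t\<bar> powr (- (1 + \<gamma>)))" by (rule Bochner_Integration.integrable_add)
  moreover have "indicator {0<..1} \<bar>t\<bar> * \<bar>t\<bar> powr (3 - \<gamma>)
      + indicator {1<..} \<bar>t\<bar> * \<bar>t\<bar> powr (- (1 + \<gamma>)) = tail_weight \<gamma> t" for t
    by (auto simp: tail_weight_def indicator_def)
  ultimately show ?thesis by (simp add: fun_eq_iff[symmetric])
qed

text \<open>Removing the Taylor terms of the cosine up to order 2 tames the singularity at
  \<open>t = 0\<close>. The quadratic term is cut off because without the cutoff the integral would
  diverge at infinity for \<open>\<gamma> \<le> 2\<close> and nonzero \<open>x\<close>.\<close>

definition cos_kernel :: "real \<Rightarrow> real \<Rightarrow> real \<Rightarrow> real" where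
  "cos_kernel \<gamma> x t = (cos (x * t) - 1 + (if \<bar>t\<bar> \<le> 1 then (x * t)\<^sup>2 / 2 else 0)) / \<bar>t\<bar> powr (1 + \<gamma>)"

definition cos_potential :: "real \<Rightarrow> real \<Rightarrow> real" where
  "cos_potential \<gamma> x = (LINT t|lborel. cos_kernel \<gamma> x t)"

lemma borel_measurable_cos_kernel [measurable]: "cos_kernel \<gamma> x \<in> borel_measurable borel"
  unfolding cos_kernel_def by measurable

text \<open>The cubic term of \<open>iexp u\<close> is imaginary, so the remainder of order 3 bounds
  the real part by a fourth power.\<close>

lemma cos_taylor_bound: "\<bar>cos u - 1 + u\<^sup>2 / 2\<bar> \<le> u ^ 4 / 24" for u :: real
proof -
  have "\<bar>Re (iexp u - (\<Sum>k\<le>3. (\<i> * u) ^ k / fact k))\<bar> \<le> \<bar>u\<bar> ^ Suc 3 / fact (Suc 3)"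
    by (rule order_trans[OF abs_Re_le_cmod iexp_approx1])
  moreover have "Re (iexp u - (\<Sum>k\<le>3. (\<i> * u) ^ k / fact k)) = cos u - 1 + u\<^sup>2 / 2"
    by (simp add: eval_nat_numeral fact_reduce Re_divide Re_exp Im_divide power2_eq_square)
  ultimately show ?thesis by (simp add: fact_numeral)
qed

text \<open>Inside the cutoff the Taylor remainder gives the factor \<open>x ^ 4 / 24\<close>,
  outside it the cosine difference is at most 2; the factor \<open>x ^ 4 + 2\<close> covers
  both.\<close>

lemma cos_kernel_bound: "\<bar>cos_kernel \<gamma> x t\<bar> \<le> (x ^ 4 + 2) * tail_weight \<gamma> t"
proof (cases "\<bar>t\<bar> \<le> 1")
  case True
  show ?thesis
  proof (cases "t = 0")
    case False
    have "\<bar>cos_kernel \<gamma> x t\<bar> = \<bar>cos (x * t) - 1 + (x * t)\<^sup>2 / 2\<bar> / \<bar>t\<bar> powr (1 + \<gamma>)"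
      using True by (simp add: cos_kernel_def)
    also have "\<dots> \<le> ((x * t) ^ 4 / 24) / \<bar>t\<bar> powr (1 + \<gamma>)"
      by (intro divide_right_mono cos_taylor_bound) simp
    also have "\<dots> = x ^ 4 / 24 * (\<bar>t\<bar> powr 4 / \<bar>t\<bar> powr (1 + \<gamma>))"
      using False by (simp add: power_mult_distrib)
    also have "\<bar>t\<bar> powr 4 / \<bar>t\<bar> powr (1 + \<gamma>) = tail_weight \<gamma> t"
      using True powr_diff[of "\<bar>t\<bar>" 4 "1 + \<gamma>"] by (simp add: tail_weight_def)
    also have "x ^ 4 / 24 * tail_weight \<gamma> t \<le> (x ^ 4 + 2) * tail_weight \<gamma> t"
      by (rule mult_right_mono) (auto simp: tail_weight_def field_simps intro!: add_increasing)
    finally show ?thesis .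
  qed (simp add: cos_kernel_def tail_weight_def)
next
  case False
  have "\<bar>cos (x * t) - 1\<bar> \<le> 2" using cos_le_one[of "x * t"] cos_ge_minus_one[of "x * t"] by linarith
  then have "\<bar>cos_kernel \<gamma> x t\<bar> \<le> 2 / \<bar>t\<bar> powr (1 + \<gamma>)"
    using False by (auto simp: cos_kernel_def intro!: divide_right_mono)
  also have "\<dots> = 2 * tail_weight \<gamma> t"
    using False powr_minus[of "\<bar>t\<bar>" "1 + \<gamma>"] by (simp add: tail_weight_def divide_inverse)
  also have "\<dots> \<le> (x ^ 4 + 2) * tail_weight \<gamma> t"
    by (rule mult_right_mono) (auto simp: tail_weight_def)
  finally show ?thesis .
qed

lemma integrable_cos_kernel:
  assumes "0 < \<gamma>" "\<gamma> < 4"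
  shows "integrable lborel (cos_kernel \<gamma> x)"
proof (rule Bochner_Integration.integrable_bound[OF integrable_mult_right[OF integrable_tail_weight[OF assms], of "x ^ 4 + 2"]])
  show "AE t in lborel. norm (cos_kernel \<gamma> x t) \<le> norm ((x ^ 4 + 2) * tail_weight \<gamma> t)"
    by (rule AE_I2) (use cos_kernel_bound in \<open>auto intro: order_trans[OF _ abs_ge_self]\<close>)
qed measurable

section \<open>Scaling of the potential and its closed form\<close>

text \<open>The antiderivative \<open>G\<close> stays abstract so that the logarithmic and the power
  case share one computation.\<close>

lemma has_bochner_integral_annulus:
  assumes ab: "0 < a" "a \<le> b"
    and G: "\<And>s. 0 < s \<Longrightarrow> (G has_real_derivative s powr p) (at s)"
  shows "has_bochner_integral lborel (\<lambda>s::real. if a < \<bar>s\<bar> \<and> \<bar>s\<bar> \<le> b then \<bar>s\<bar> powr p else 0) (2 * (G b - G a))"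
proof -
  have 1: "has_bochner_integral lborel (\<lambda>s. s powr p * indicator {a..b} s) (G b - G a)"
    by (rule has_bochner_integral_FTC_Icc_real) (use ab in \<open>auto intro!: G continuous_intros\<close>)
  have "has_bochner_integral lborel (\<lambda>s. s powr p * indicator {a..b} s + (-s) powr p * indicator {a..b} (-s))
     ((G b - G a) + (G b - G a))"
    by (intro has_bochner_integral_add 1 has_bochner_integral_reflect[OF 1])
  then have *: "has_bochner_integral lborel (\<lambda>s. s powr p * indicator {a..b} s + (-s) powr p * indicator {a..b} (-s))
     (2 * (G b - G a))" by simp
  show ?thesis
  proof (rule has_bochner_integralI_AE[OF *])
    \<comment> \<open>The half-open annulus and the two closed intervals differ only at
      \<open>a\<close> and \<open>-a\<close>.\<close>
    show "AE s in lborel. s powr p * indicator {a..b} s + (-s) powr p * indicator {a..b} (-s)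
        = (if a < \<bar>s\<bar> \<and> \<bar>s\<bar> \<le> b then \<bar>s\<bar> powr p else 0)"
      using AE_lborel_singleton[of a] AE_lborel_singleton[of "-a"]
      by eventually_elim (use ab in \<open>auto simp: indicator_def abs_if\<close>)
  qed measurable
qed

text \<open>The substitution \<open>t = s / r\<close> reproduces the kernel at 1 up to
  \<open>r powr (1 + \<gamma>)\<close>, except that the cutoff moves to \<open>|s| \<le> r\<close>.
  The mismatch \<open>J\<close> of the two cutoffs lives on an annulus and integrates to
  \<open>G r - G 1\<close>; the Jacobian lowers the exponent to \<open>\<gamma>\<close>.\<close>

lemma cos_potential_scale:
  assumes \<gamma>: "0 < \<gamma>" "\<gamma> < 4" and r: "0 < r"
    and G: "\<And>s. 0 < s \<Longrightarrow> (G has_real_derivative s powr (1 - \<gamma>)) (at s)"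
  shows "cos_potential \<gamma> r = r powr \<gamma> * (cos_potential \<gamma> 1 + (G r - G 1))"
proof -
  define J where "J s = ((if \<bar>s\<bar> \<le> r then s\<^sup>2 / 2 else 0) - (if \<bar>s\<bar> \<le> 1 then s\<^sup>2 / 2 else 0)) / \<bar>s\<bar> powr (1 + \<gamma>)" for s :: real
  have pw: "s\<^sup>2 / 2 / \<bar>s\<bar> powr (1 + \<gamma>) = 1/2 * \<bar>s\<bar> powr (1 - \<gamma>)" for s :: real
  proof (cases "s = 0")
    case False
    then have "s\<^sup>2 / \<bar>s\<bar> powr (1 + \<gamma>) = \<bar>s\<bar> powr 2 / \<bar>s\<bar> powr (1 + \<gamma>)" by simp
    also have "\<dots> = \<bar>s\<bar> powr (2 - (1 + \<gamma>))" by (rule powr_diff[symmetric])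
    finally show ?thesis by simp
  qed simp
  have J: "has_bochner_integral lborel J (G r - G 1)"
  proof (cases "1 \<le> r")
    case True
    have "J = (\<lambda>s. 1/2 * (if 1 < \<bar>s\<bar> \<and> \<bar>s\<bar> \<le> r then \<bar>s\<bar> powr (1 - \<gamma>) else 0))"
      using True pw by (auto simp: J_def fun_eq_iff)
    then show ?thesis
      using has_bochner_integral_mult_right[OF has_bochner_integral_annulus[OF _ True G], of "1/2"]
      by (simp add: diff_divide_distrib)
  next
    case False
    then have r1: "r \<le> 1" by simp
    have "J = (\<lambda>s. - 1/2 * (if r < \<bar>s\<bar> \<and> \<bar>s\<bar> \<le> 1 then \<bar>s\<bar> powr (1 - \<gamma>) else 0))"
      using r1 pw by (auto simp: J_def fun_eq_iff)
    then show ?thesis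
      using has_bochner_integral_mult_right[OF has_bochner_integral_annulus[OF r r1 G], of "-1/2"]
      by (simp add: diff_divide_distrib)
  qed
  have K: "cos_kernel \<gamma> r (s / r) = r powr (1 + \<gamma>) * (cos_kernel \<gamma> 1 s + J s)" for s
    using r by (auto simp: cos_kernel_def J_def powr_divide abs_divide field_simps)
  have "cos_potential \<gamma> r = 1 / r * (LINT s|lborel. cos_kernel \<gamma> r (s / r))"
    unfolding cos_potential_def using r
    by (subst lborel_integral_real_affine[where c="1 / r" and t=0]) auto
  also have "(LINT s|lborel. cos_kernel \<gamma> r (s / r))
     = r powr (1 + \<gamma>) * (cos_potential \<gamma> 1 + (G r - G 1))"
    unfolding cos_potential_def K
    using J integrable_cos_kernel[OF \<gamma>, of 1] by (simp add: has_bochner_integral_iff)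
  also have "1 / r * (r powr (1 + \<gamma>) * (cos_potential \<gamma> 1 + (G r - G 1)))
     = r powr \<gamma> * (cos_potential \<gamma> 1 + (G r - G 1))"
    using r by (simp add: powr_add)
  finally show ?thesis .
qed

lemma cos_kernel_abs: "cos_kernel \<gamma> \<bar>x\<bar> t = cos_kernel \<gamma> x t"
  by (auto simp: cos_kernel_def abs_if)

text \<open>In \<open>cos_potential_scale\<close>, \<open>G = ln\<close> for
  \<open>\<gamma> = 2\<close> produces the logarithm with coefficient 1. Otherwise
  \<open>G s = s powr (2 - \<gamma>) / (2 - \<gamma>)\<close>, whose product with
  \<open>r powr \<gamma>\<close> at \<open>s = r\<close> is the quadratic term.\<close>

lemma cos_potential_eq_phi:
  assumes \<gamma>: "0 < \<gamma>" "\<gamma> < 4"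
  obtains c d where "\<And>x. cos_potential \<gamma> x = c * phi \<gamma> x + d * x\<^sup>2" "\<gamma> = 2 \<Longrightarrow> c = 1"
proof -
  \<comment> \<open>Below 4 the only even positive integer is 2, so the logarithmic branch of
    \<open>phi\<close> occurs there alone.\<close>
  have even: "(\<exists>m::nat. 0 < m \<and> \<gamma> = 2 * real m) \<longleftrightarrow> \<gamma> = 2"
  proof
    assume "\<exists>m::nat. 0 < m \<and> \<gamma> = 2 * real m"
    then obtain m :: nat where "0 < m" "\<gamma> = 2 * real m" by blast
    with \<gamma> have "m = 1" by auto
    then show "\<gamma> = 2" using \<open>\<gamma> = 2 * real m\<close> by simp
  qed (auto intro!: exI[of _ 1])
  have 0: "cos_potential \<gamma> 0 = 0" proof -
    have "cos_kernel \<gamma> 0 = (\<lambda>_. 0)" by (auto simp: cos_kernel_def)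
    then show ?thesis by (simp add: cos_potential_def)
  qed
  have abs: "cos_potential \<gamma> x = cos_potential \<gamma> \<bar>x\<bar>" for x
    by (simp add: cos_potential_def cos_kernel_abs)
  show thesis
  proof (cases "\<gamma> = 2")
    case True
    have "(ln has_real_derivative s powr (1 - \<gamma>)) (at s)" if "0 < s" for s
      using that True by (auto intro!: derivative_eq_intros simp: powr_minus divide_inverse)
    then have *: "cos_potential \<gamma> \<bar>x\<bar> = \<bar>x\<bar> powr \<gamma> * (cos_potential \<gamma> 1 + (ln \<bar>x\<bar> - ln 1))" if "x \<noteq> 0" for x
      using that by (intro cos_potential_scale[OF \<gamma>]) auto
    have "cos_potential \<gamma> x = 1 * phi \<gamma> x + cos_potential \<gamma> 1 * x\<^sup>2" for x
    proof (cases "x = 0")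
      case x: False
      have "phi \<gamma> x = \<bar>x\<bar> powr \<gamma> * ln \<bar>x\<bar>" 
        using even True unfolding phi_def by (metis if_P)
      moreover have "\<bar>x\<bar> powr \<gamma> = x\<^sup>2" using True x by simp
      ultimately show ?thesis by (simp add: abs[of x] *[OF x] algebra_simps)
    qed (simp add: 0 phi_def)
    then show thesis using that by blast
  next
    case False
    have "((\<lambda>s. s powr (2 - \<gamma>) / (2 - \<gamma>)) has_real_derivative s powr (1 - \<gamma>)) (at s)" if "0 < s" for s
      using that False by (auto intro!: derivative_eq_intros)
    then have *: "cos_potential \<gamma> \<bar>x\<bar> = \<bar>x\<bar> powr \<gamma> * (cos_potential \<gamma> 1 + (\<bar>x\<bar> powr (2 - \<gamma>) / (2 - \<gamma>) - 1 powr (2 - \<gamma>) / (2 - \<gamma>)))"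
      if "x \<noteq> 0" for x
      using that by (intro cos_potential_scale[OF \<gamma>]) auto
    have "cos_potential \<gamma> x = (cos_potential \<gamma> 1 - 1 / (2 - \<gamma>)) * phi \<gamma> x + 1 / (2 - \<gamma>) * x\<^sup>2" for x
    proof (cases "x = 0")
      case x: False
      have "\<bar>x\<bar> powr \<gamma> * \<bar>x\<bar> powr (2 - \<gamma>) = x\<^sup>2"
        using x by (simp flip: powr_add)
      then show ?thesis
        using False by (simp add: abs[of x] *[OF x] phi_def even ring_distribs right_diff_distrib)
    qed (use False in \<open>simp add: 0 phi_def even\<close>)
    then show thesis using that False by blast
  qed
qed

text \<open>The moment conditions remove the regularising terms of \<open>cos_kernel\<close>, so that the
  quadratic form of \<open>phi\<close> is the integral of a square.\<close>

definition exp_sum :: "'i set \<Rightarrow> ('i \<Rightarrow> real) \<Rightarrow> ('i \<Rightarrow> real) \<Rightarrow> real \<Rightarrow> complex" where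
  "exp_sum I a p t = (\<Sum>j\<in>I. complex_of_real (a j) * cis (p j * t))"

text \<open>After expanding the square, every term has a moment of order 0 or 1 as a factor. Hence
  multiples of \<open>x\<^sup>2\<close> contribute nothing to the quadratic forms below.\<close>

lemma moment_square_sum_zero:
  fixes a p :: "'i \<Rightarrow> real"
  assumes "(\<Sum>j\<in>I. a j) = 0" "(\<Sum>j\<in>I. a j * p j) = 0"
  shows "(\<Sum>j\<in>I. \<Sum>k\<in>I. a j * a k * (p j - p k)\<^sup>2) = 0"
proof -
  have "(\<Sum>j\<in>I. \<Sum>k\<in>I. a j * a k * (p j - p k)\<^sup>2)
    = (\<Sum>j\<in>I. \<Sum>k\<in>I. (a j * (p j)\<^sup>2) * a k) - 2 * (\<Sum>j\<in>I. \<Sum>k\<in>I. (a j * p j) * (a k * p k))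
      + (\<Sum>j\<in>I. \<Sum>k\<in>I. a j * (a k * (p k)\<^sup>2))"
    by (simp add: sum_distrib_left algebra_simps power2_eq_square flip: sum.distrib sum_subtractf)
  also have "\<dots> = 0"
    using assms by (simp flip: sum_product)
  finally show ?thesis .
qed

lemma cmod_exp_sum_square:
  "(cmod (exp_sum I a p t))\<^sup>2 = (\<Sum>j\<in>I. \<Sum>k\<in>I. a j * a k * cos ((p j - p k) * t))"
proof -
  have "(cmod (exp_sum I a p t))\<^sup>2 = (\<Sum>j\<in>I. a j * cos (p j * t))\<^sup>2 + (\<Sum>j\<in>I. a j * sin (p j * t))\<^sup>2"
    by (simp add: cmod_power2 exp_sum_def)
  also have "\<dots> = (\<Sum>j\<in>I. \<Sum>k\<in>I. a j * a k * cos ((p j - p k) * t))"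
    by (simp add: power2_eq_square sum_product cos_diff left_diff_distrib algebra_simps flip: sum.distrib)
  finally show ?thesis .
qed

context
  fixes I :: "'i set" and a p :: "'i \<Rightarrow> real"
  assumes m0: "(\<Sum>j\<in>I. a j) = 0" and m1: "(\<Sum>j\<in>I. a j * p j) = 0"
begin

lemma cos_kernel_quadratic_form:
  "(\<Sum>j\<in>I. \<Sum>k\<in>I. a j * a k * cos_kernel \<gamma> (p j - p k) t)
     = (cmod (exp_sum I a p t))\<^sup>2 / \<bar>t\<bar> powr (1 + \<gamma>)"
proof -
  have z: "(\<Sum>j\<in>I. \<Sum>k\<in>I. a j * a k) = 0"
    using m0 by (simp flip: sum_product)
  \<comment> \<open>The factor \<open>e\<close> is arbitrary so that one identity serves both sides
    of the cutoff: it becomes \<open>t\<^sup>2 / 2\<close> or 0 below.\<close>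
  have "(\<Sum>j\<in>I. \<Sum>k\<in>I. a j * a k * (cos ((p j - p k) * t) - 1 + e * (p j - p k)\<^sup>2))
      = (\<Sum>j\<in>I. \<Sum>k\<in>I. a j * a k * cos ((p j - p k) * t)) - (\<Sum>j\<in>I. \<Sum>k\<in>I. a j * a k)
        + e * (\<Sum>j\<in>I. \<Sum>k\<in>I. a j * a k * (p j - p k)\<^sup>2)" for e
    by (simp add: sum_distrib_left algebra_simps flip: sum.distrib sum_subtractf)
  then have *: "(\<Sum>j\<in>I. \<Sum>k\<in>I. a j * a k * (cos ((p j - p k) * t) - 1 + e * (p j - p k)\<^sup>2))
     = (cmod (exp_sum I a p t))\<^sup>2" for e
    using z moment_square_sum_zero[OF m0 m1] by (simp add: cmod_exp_sum_square)
  have "cos_kernel \<gamma> x t = (cos (x * t) - 1 + (if \<bar>t\<bar> \<le> 1 then t\<^sup>2 / 2 else 0) * x\<^sup>2) / \<bar>t\<bar> powr (1 + \<gamma>)" for x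
    by (auto simp: cos_kernel_def power_mult_distrib)
  then have "(\<Sum>j\<in>I. \<Sum>k\<in>I. a j * a k * cos_kernel \<gamma> (p j - p k) t)
    = (\<Sum>j\<in>I. \<Sum>k\<in>I. a j * a k * (cos ((p j - p k) * t) - 1 + (if \<bar>t\<bar> \<le> 1 then t\<^sup>2 / 2 else 0) * (p j - p k)\<^sup>2)) / \<bar>t\<bar> powr (1 + \<gamma>)"
    by (simp only: sum_divide_distrib times_divide_eq_right)
  then show ?thesis unfolding * .
qed

lemma has_bochner_integral_exp_sum_square:
  assumes "0 < \<gamma>" "\<gamma> < 4"
  shows "has_bochner_integral lborel (\<lambda>t. (cmod (exp_sum I a p t))\<^sup>2 / \<bar>t\<bar> powr (1 + \<gamma>))
     (\<Sum>j\<in>I. \<Sum>k\<in>I. a j * a k * cos_potential \<gamma> (p j - p k))"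
  unfolding cos_kernel_quadratic_form[symmetric] cos_potential_def
  by (intro has_bochner_integral_sum has_bochner_integral_mult_right has_bochner_integral_integrable
      integrable_cos_kernel assms)

lemma phi_quadratic_form:
  assumes "0 < \<gamma>" "\<gamma> < 4" and "\<And>x. cos_potential \<gamma> x = c * phi \<gamma> x + d * x\<^sup>2"
  shows "(LINT t|lborel. (cmod (exp_sum I a p t))\<^sup>2 / \<bar>t\<bar> powr (1 + \<gamma>))
     = c * (\<Sum>j\<in>I. \<Sum>k\<in>I. a j * a k * phi \<gamma> (p j - p k))"
proof -
  have "(LINT t|lborel. (cmod (exp_sum I a p t))\<^sup>2 / \<bar>t\<bar> powr (1 + \<gamma>))
     = (\<Sum>j\<in>I. \<Sum>k\<in>I. a j * a k * (c * phi \<gamma> (p j - p k) + d * (p j - p k)\<^sup>2))"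
    using has_bochner_integral_exp_sum_square[OF assms(1,2)] assms(3)
    by (simp add: has_bochner_integral_iff)
  also have "\<dots> = c * (\<Sum>j\<in>I. \<Sum>k\<in>I. a j * a k * phi \<gamma> (p j - p k))
      + d * (\<Sum>j\<in>I. \<Sum>k\<in>I. a j * a k * (p j - p k)\<^sup>2)"
    by (simp add: sum_distrib_left algebra_simps flip: sum.distrib)
  finally show ?thesis using moment_square_sum_zero[OF m0 m1] by simp
qed

end

section \<open>Strict positivity of the quadratic form\<close>

text \<open>At equispaced points the exponential sum is a polynomial in \<open>cis (h * t)\<close>.
  A zero integral makes it vanish almost everywhere, whereas a nonzero polynomial has finitely many
  roots.\<close>

lemma exp_sum_equispaced_integral_zero:
  assumes \<gamma>: "0 < \<gamma>" "\<gamma> < 4" and h: "h > 0"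
    and m0: "(\<Sum>j\<le>n. a j) = 0" and m1: "(\<Sum>j\<le>n. a j * (h * real j)) = 0"
    and z: "(LINT t|lborel. (cmod (exp_sum {..n} a (\<lambda>j. h * real j) t))\<^sup>2 / \<bar>t\<bar> powr (1 + \<gamma>)) = 0"
  shows "\<forall>j\<le>n. a j = 0"
proof (rule ccontr)
  assume "\<not> ?thesis"
  then obtain k where k: "k \<le> n" "complex_of_real (a k) \<noteq> 0" by auto
  let ?E = "exp_sum {..n} a (\<lambda>j. h * real j)"
  have E: "?E t = (\<Sum>j\<le>n. complex_of_real (a j) * cis (h * t) ^ j)" for t
    unfolding exp_sum_def Complex.DeMoivre by (simp add: mult_ac)
  have "integrable lborel (\<lambda>t. (cmod (?E t))\<^sup>2 / \<bar>t\<bar> powr (1 + \<gamma>))"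
    using has_bochner_integral_exp_sum_square[OF m0 m1 \<gamma>] by (simp add: has_bochner_integral_iff)
  then have "AE t in lborel. (cmod (?E t))\<^sup>2 / \<bar>t\<bar> powr (1 + \<gamma>) = 0"
    using z by (subst (asm) integral_nonneg_eq_0_iff_AE) auto
  then have ae: "AE t in lborel. t = 0 \<or> ?E t = 0" by eventually_elim auto
  \<comment> \<open>Here \<open>cis (h * t)\<close> is injective, as the cosine is injective on
    \<open>[0, pi]\<close>; finitely many roots therefore give finitely many
    \<open>t\<close>.\<close>
  let ?U = "{0<..<pi / h}"
  let ?Z = "{t \<in> ?U. ?E t = 0}"
  have "finite ((\<lambda>t. cis (h * t)) ` ?Z)"
    by (rule finite_subset[OF _ polyfun_roots_finite[where c="\<lambda>j. complex_of_real (a j)", OF k(2,1)]]) (auto simp: E)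
  moreover have "inj_on (\<lambda>t. cis (h * t)) ?Z"
  proof (rule inj_onI)
    fix s t assume st: "s \<in> ?Z" "t \<in> ?Z" "cis (h * s) = cis (h * t)"
    have b: "0 \<le> h * u \<and> h * u \<le> pi" if "u \<in> ?Z" for u
      using that h pos_less_divide_eq[of h u pi] by (simp add: mult.commute)
    have "h * s = h * t"
    proof (rule cos_inj_pi)
      show "cos (h * s) = cos (h * t)" using st(3) by (metis cis.sel(1))
    qed (use b st in simp_all)
    then show "s = t" using h by simp
  qed
  ultimately have "finite ?Z" by (rule finite_imageD)
  then have "AE t in lborel. t \<notin> ?Z" by (intro AE_not_in finite_imp_null_set_lborel)
  with ae have "AE t in lborel. t \<notin> ?U"
    by eventually_elim auto
  then have "?U \<in> null_sets lborel"
    by (subst AE_iff_null_sets) auto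
  then have "emeasure lborel ?U = 0" by (rule null_setsD1)
  then show False using h by simp
qed

text \<open>If \<open>c\<close> were 0, the form would vanish for all coefficients with zero
  moments, against strict positivity.\<close>

lemma cos_potential_coeff_nonzero:
  assumes \<gamma>: "0 < \<gamma>" "\<gamma> < 4" and "\<And>x. cos_potential \<gamma> x = c * phi \<gamma> x + d * x\<^sup>2"
  shows "c \<noteq> 0"
proof
  assume c: "c = 0"
  \<comment> \<open>The second difference \<open>1, -2, 1\<close> at 0, 1, 2 annihilates affine
    functions, so both moments vanish.\<close>
  define a :: "nat \<Rightarrow> real" where "a j = (if j = 1 then - 2 else 1)" for j
  have m: "(\<Sum>j\<le>2. a j) = 0" "(\<Sum>j\<le>2. a j * (1 * real j)) = 0"
    by (simp_all add: a_def eval_nat_numeral)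
  have "(LINT t|lborel. (cmod (exp_sum {..2} a (\<lambda>j. 1 * real j) t))\<^sup>2 / \<bar>t\<bar> powr (1 + \<gamma>)) = 0"
    using phi_quadratic_form[OF m \<gamma> assms(3)] c by simp
  then have "\<forall>j\<le>2. a j = 0"
    by (intro exp_sum_equispaced_integral_zero[OF \<gamma> _ m]) auto
  then show False by (auto simp: a_def)
qed

section \<open>Pairing the potential with transforms of test functions\<close>

text \<open>Averaging the inversion formula at \<open>t\<close> and \<open>- t\<close> turns the
  exponentials into a cosine.\<close>

lemma fourier_cos_inversion:
  fixes D :: "nat \<Rightarrow> real \<Rightarrow> complex"
  assumes "is_Ck_chain k D R" "2 \<le> k"
  shows "has_bochner_integral lborel (\<lambda>x. complex_of_real (cos (x * t)) * fourier (D 0) x) (pi * (D 0 t + D 0 (- t)))"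
proof -
  have [measurable]: "D 0 \<in> borel_measurable borel" using chain_integrable[OF assms(1), of 0] by simp
  have i: "integrable lborel (fourier (D 0))"
    by (rule Bochner_Integration.integrable_bound[OF integrable_fourier_chain[OF assms(1), of 0]]) (use assms in auto)
  have inv: "has_bochner_integral lborel (\<lambda>x. cis (x * s) * fourier (D 0) x) (2 * pi * D 0 s)" for s
    using fourier_inversion_chain[OF assms(1), of 0 s] assms(2) i
    by (auto simp: has_bochner_integral_iff mult_ac)
  have "has_bochner_integral lborel
     (\<lambda>x. (cis (x * t) * fourier (D 0) x + cis (x * - t) * fourier (D 0) x) / 2) ((2 * pi * D 0 t + 2 * pi * D 0 (- t)) / 2)"
    by (intro has_bochner_integral_divide_zero has_bochner_integral_add inv)
  moreover have "(cis (x * t) * fourier (D 0) x + cis (x * - t) * fourier (D 0) x) / 2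
      = complex_of_real (cos (x * t)) * fourier (D 0) x" for x
  proof -
    have "cis (x * t) + cis (x * - t) = 2 * complex_of_real (cos (x * t))"
      by (simp add: complex_eq_iff)
    then show ?thesis by (simp flip: distrib_right)
  qed
  ultimately show ?thesis by (simp add: algebra_simps add_divide_distrib)
qed

text \<open>The support is closed and misses 0, so \<open>g\<close> vanishes near 0 and
  \<open>1 / |t| powr (1 + \<gamma>)\<close> is bounded elsewhere.\<close>

lemma integrable_over_powr:
  fixes g :: "real \<Rightarrow> complex"
  assumes g: "integrable lborel g" and z: "0 \<notin> supp g" and \<gamma>: "0 < \<gamma>"
  shows "integrable lborel (\<lambda>t. g t / complex_of_real (\<bar>t\<bar> powr (1 + \<gamma>)))"
proof -
  have [measurable]: "g \<in> borel_measurable borel" using g by simp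
  have "open (- supp g)" unfolding supp_def by auto
  then obtain e where e: "e > 0" "\<And>t. dist t 0 < e \<Longrightarrow> t \<in> - supp g"
    using z unfolding open_dist by blast
  have zero: "g t = 0" if "\<bar>t\<bar> < e" for t
    using e(2)[of t] that by (auto simp: zero_outside_supp)
  show ?thesis
  proof (rule Bochner_Integration.integrable_bound[OF integrable_mult_right[OF integrable_norm[OF g], of "inverse (e powr (1 + \<gamma>))"]])
    show "AE t in lborel. norm (g t / complex_of_real (\<bar>t\<bar> powr (1 + \<gamma>))) \<le> norm (inverse (e powr (1 + \<gamma>)) * norm (g t))"
    proof (rule AE_I2)
      fix t
      show "norm (g t / complex_of_real (\<bar>t\<bar> powr (1 + \<gamma>))) \<le> norm (inverse (e powr (1 + \<gamma>)) * norm (g t))"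
      proof (cases "\<bar>t\<bar> < e")
        case False
        then have "e powr (1 + \<gamma>) \<le> \<bar>t\<bar> powr (1 + \<gamma>)" using e(1) \<gamma> by (intro powr_mono2) auto
        then have "inverse (\<bar>t\<bar> powr (1 + \<gamma>)) \<le> inverse (e powr (1 + \<gamma>))"
          using e(1) by (intro le_imp_inverse_le) auto
        then show ?thesis
          by (simp add: norm_mult norm_inverse divide_inverse mult.commute mult_left_mono)
      qed (simp add: zero)
    qed
  qed measurable
qed

lemma cos_potential_bound:
  assumes "0 < \<gamma>" "\<gamma> < 4"
  shows "\<bar>cos_potential \<gamma> x\<bar> \<le> (x ^ 4 + 2) * (LINT t|lborel. tail_weight \<gamma> t)"
proof -
  have "\<bar>cos_potential \<gamma> x\<bar> \<le> (LINT t|lborel. \<bar>cos_kernel \<gamma> x t\<bar>)"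
    unfolding cos_potential_def using integral_norm_bound[of lborel "cos_kernel \<gamma> x"] by simp
  also have "\<dots> \<le> (LINT t|lborel. (x ^ 4 + 2) * tail_weight \<gamma> t)"
    by (rule integral_mono) (use assms cos_kernel_bound in \<open>auto intro!: integrable_mult_right integrable_tail_weight integrable_abs integrable_cos_kernel\<close>)
  finally show ?thesis by simp
qed

text \<open>Fubini leaves three integrals in \<open>x\<close> for each \<open>t\<close>: the cosine
  gives \<open>D 0\<close> at \<open>t\<close> and \<open>- t\<close>, the constant gives a multiple
  of \<open>D 0 0 = 0\<close>, the quadratic term a multiple of \<open>D 2 0 = 0\<close>. Of the six
  derivatives four absorb the bound \<open>x ^ 4 + 2\<close> of the potential and two give
  integrability.\<close>

theorem gft_cos_potential:
  fixes D :: "nat \<Rightarrow> real \<Rightarrow> complex"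
  assumes \<gamma>: "0 < \<gamma>" "\<gamma> < 4"
    and D: "is_Ck_chain 6 D R" and supp: "0 \<notin> supp (D 0)" and D2: "D 2 0 = 0"
  shows "has_bochner_integral lborel (\<lambda>x. complex_of_real (cos_potential \<gamma> x) * fourier (D 0) x)
     (2 * pi * (LINT t|lborel. D 0 t / complex_of_real (\<bar>t\<bar> powr (1 + \<gamma>))))"
    and "has_bochner_integral lborel (\<lambda>x. complex_of_real (x\<^sup>2) * fourier (D 0) x) 0"
proof -
  let ?g = "fourier (D 0)"
  have gi: "integrable lborel (D 0)" using chain_integrable[OF D, of 0] by simp
  have [measurable]: "D 0 \<in> borel_measurable borel" using gi by simp
  have i: "integrable lborel (\<lambda>x. \<bar>x\<bar> ^ m * cmod (?g x))" if "m \<le> 4" for m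
    using integrable_fourier_chain[OF D, of m] that by simp
  have i2: "integrable lborel (\<lambda>x. complex_of_real (x\<^sup>2) * ?g x)"
    by (rule Bochner_Integration.integrable_bound[OF i[of 2]]) (auto simp: norm_mult norm_power)
  have "(LINT t|lborel. complex_of_real (t\<^sup>2) * ?g t) = - (LINT t|lborel. (\<i> * t) ^ 2 * ?g t * cis (0 * t))"
    by (simp add: power_mult_distrib)
  also have "\<dots> = 0"
    using fourier_inversion_chain[OF D, of 2 0] D2 by simp
  finally show 2: "has_bochner_integral lborel (\<lambda>x. complex_of_real (x\<^sup>2) * ?g x) 0"
    using i2 by (simp add: has_bochner_integral_iff)
  show "has_bochner_integral lborel (\<lambda>x. complex_of_real (cos_potential \<gamma> x) * ?g x)
     (2 * pi * (LINT t|lborel. D 0 t / complex_of_real (\<bar>t\<bar> powr (1 + \<gamma>))))"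
  proof -
    define F where "F t x = complex_of_real (cos_kernel \<gamma> x t) * ?g x" for t x
    have iw: "integrable lborel (\<lambda>x. (x ^ 4 + 2) * cmod (?g x))"
      using Bochner_Integration.integrable_add[OF i[of 4] integrable_mult_right[OF i[of 0], of 2]]
      by (simp add: distrib_right)
    have intF: "integrable (lborel \<Otimes>\<^sub>M lborel) (case_prod F)"
    proof (rule integrable_pair_bound[OF _ integrable_tail_weight[OF \<gamma>] iw])
      show "case_prod F \<in> borel_measurable (lborel \<Otimes>\<^sub>M lborel)"
        unfolding F_def cos_kernel_def by measurable
      show "cmod (F t x) \<le> tail_weight \<gamma> t * ((x ^ 4 + 2) * cmod (?g x))" for t x
        unfolding F_def norm_mult norm_of_real
        using mult_right_mono[OF cos_kernel_bound[of \<gamma> x t], of "cmod (?g x)"] by (simp add: mult_ac)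
    qed
    have D0: "D 0 0 = 0" using supp by (rule zero_outside_supp)
    have inner: "(LINT x|lborel. F t x) = pi * (D 0 t + D 0 (- t)) / complex_of_real (\<bar>t\<bar> powr (1 + \<gamma>))" for t
    proof -
      define e where "e = complex_of_real (if \<bar>t\<bar> \<le> 1 then t\<^sup>2 / 2 else 0)"
      have "F t x = (complex_of_real (cos (x * t)) * ?g x - complex_of_real (cos (x * 0)) * ?g x
          + e * (complex_of_real (x\<^sup>2) * ?g x)) / complex_of_real (\<bar>t\<bar> powr (1 + \<gamma>))" for x
        unfolding F_def cos_kernel_def e_def by (auto simp: algebra_simps power_mult_distrib)
      moreover have "has_bochner_integral lborel (\<lambda>x. (complex_of_real (cos (x * t)) * ?g x - complex_of_real (cos (x * 0)) * ?g x
          + e * (complex_of_real (x\<^sup>2) * ?g x)) / complex_of_real (\<bar>t\<bar> powr (1 + \<gamma>)))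
         ((pi * (D 0 t + D 0 (- t)) - pi * (D 0 0 + D 0 (- 0)) + e * 0) / complex_of_real (\<bar>t\<bar> powr (1 + \<gamma>)))"
        by (intro has_bochner_integral_divide_zero has_bochner_integral_add has_bochner_integral_diff
            has_bochner_integral_mult_right 2 fourier_cos_inversion[OF D]) simp_all
      ultimately show ?thesis using D0 by (simp add: has_bochner_integral_iff)
    qed
    have "integrable lborel (\<lambda>x. complex_of_real (cos_potential \<gamma> x) * ?g x)"
    proof (rule Bochner_Integration.integrable_bound[OF integrable_mult_right[OF iw, of "LINT t|lborel. tail_weight \<gamma> t"]])
      have [measurable]: "cos_potential \<gamma> \<in> borel_measurable borel"
        unfolding cos_potential_def[abs_def] cos_kernel_def by measurable
      show "(\<lambda>x. complex_of_real (cos_potential \<gamma> x) * ?g x) \<in> borel_measurable lborel" by measurable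
      show "AE x in lborel. norm (complex_of_real (cos_potential \<gamma> x) * ?g x)
          \<le> norm ((LINT t|lborel. tail_weight \<gamma> t) * ((x ^ 4 + 2) * cmod (?g x)))"
      proof (rule AE_I2)
        fix x
        show "norm (complex_of_real (cos_potential \<gamma> x) * ?g x)
          \<le> norm ((LINT t|lborel. tail_weight \<gamma> t) * ((x ^ 4 + 2) * cmod (?g x)))"
          using mult_right_mono[OF order_trans[OF cos_potential_bound[OF \<gamma>, of x] abs_ge_self], of "cmod (?g x)"]
          by (simp add: norm_mult abs_mult mult_ac)
      qed
    qed
    moreover have "(LINT x|lborel. complex_of_real (cos_potential \<gamma> x) * ?g x)
        = 2 * pi * (LINT t|lborel. D 0 t / complex_of_real (\<bar>t\<bar> powr (1 + \<gamma>)))"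
    proof -
      let ?q = "\<lambda>t. D 0 t / complex_of_real (\<bar>t\<bar> powr (1 + \<gamma>))"
      have q: "has_bochner_integral lborel ?q (LINT t|lborel. ?q t)"
        by (rule has_bochner_integral_integrable[OF integrable_over_powr[OF gi supp \<gamma>(1)]])
      have "(LINT x|lborel. complex_of_real (cos_potential \<gamma> x) * ?g x) = (LINT x|lborel. LINT t|lborel. F t x)"
        unfolding F_def cos_potential_def by simp
      also have "\<dots> = (LINT t|lborel. LINT x|lborel. F t x)"
        using lborel_pair.Fubini_integral[OF intF] by simp
      \<comment> \<open>The weight is even, so the two terms are reflections of each other and
        \<open>pi\<close> doubles to \<open>2 * pi\<close>.\<close>
      also have "\<dots> = (LINT t|lborel. pi * (?q t + ?q (- t)))"
        unfolding inner by (rule Bochner_Integration.integral_cong) (simp_all add: add_divide_distrib distrib_left)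
      also have "\<dots> = pi * ((LINT t|lborel. ?q t) + (LINT t|lborel. ?q t))"
        by (intro has_bochner_integral_integral_eq has_bochner_integral_mult_right has_bochner_integral_add
            q has_bochner_integral_reflect[OF q])
      finally show ?thesis by simp
    qed
    ultimately show ?thesis by (simp add: has_bochner_integral_iff)
  qed
qed

text \<open>Because \<open>gft_const\<close> is chosen by \<open>SOME\<close>, one nonzero witness
  suffices. Solving the closed form of the potential for \<open>phi\<close> and applying
  \<open>gft_cos_potential\<close> gives \<open>2 * pi / c\<close>.\<close>

theorem gft_const_nonzero:
  assumes \<gamma>: "0 < \<gamma>" "\<gamma> < 4"
  shows "gft_const \<gamma> \<noteq> 0"
proof -
  obtain c d where cd: "\<And>x. cos_potential \<gamma> x = c * phi \<gamma> x + d * x\<^sup>2"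
    using cos_potential_eq_phi[OF \<gamma>] by metis
  have c: "c \<noteq> 0" by (rule cos_potential_coeff_nonzero[OF \<gamma> cd])
  have "gft_coincides_off_0 (phi \<gamma>) (\<lambda>t. (2 * pi / c) / \<bar>t\<bar> powr (1 + \<gamma>))"
    unfolding gft_coincides_off_0_def
  proof (intro allI impI)
    fix \<psi> :: "real \<Rightarrow> complex"
    assume \<psi>: "(\<forall>k. Ck_on k \<psi> UNIV) \<and> compact (supp \<psi>) \<and> 0 \<notin> supp \<psi>"
    obtain D R where D: "D 0 = \<psi>" "is_Ck_chain 6 D R" and z: "\<And>i x. i \<le> 6 \<Longrightarrow> x \<notin> supp \<psi> \<Longrightarrow> D i x = 0"
      using Ck_on_compact_supp_chain[of 6 \<psi>] \<psi> by metis
    let ?q = "LINT t|lborel. \<psi> t / complex_of_real (\<bar>t\<bar> powr (1 + \<gamma>))"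
    have "0 \<notin> supp (D 0)" "D 2 0 = 0" using \<psi> D(1) z[of 2 0] by auto
    note G = gft_cos_potential[OF \<gamma> D(2) this, unfolded D(1)]
    have "has_bochner_integral lborel (\<lambda>x. (complex_of_real (cos_potential \<gamma> x) * fourier \<psi> x
        - d * (complex_of_real (x\<^sup>2) * fourier \<psi> x)) / c) ((2 * pi * ?q - complex_of_real d * 0) / c)"
      by (intro has_bochner_integral_divide_zero has_bochner_integral_diff has_bochner_integral_mult_right G)
    moreover have "(complex_of_real (cos_potential \<gamma> x) * fourier \<psi> x
        - d * (complex_of_real (x\<^sup>2) * fourier \<psi> x)) / c = complex_of_real (phi \<gamma> x) * fourier \<psi> x" for x
      using c by (simp add: cd field_simps)
    ultimately have "has_bochner_integral lborel (\<lambda>x. complex_of_real (phi \<gamma> x) * fourier \<psi> x)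
        ((2 * pi * ?q - complex_of_real d * 0) / c)"
      by (simp only:)
    then have "(LINT x|lborel. complex_of_real (phi \<gamma> x) * fourier \<psi> x) = 2 * pi * ?q / c"
      using has_bochner_integral_integral_eq by fastforce
    also have "\<dots> = (LINT t|lborel. complex_of_real ((2 * pi / c) / \<bar>t\<bar> powr (1 + \<gamma>)) * \<psi> t)"
      by (subst integral_mult_right_zero[symmetric], subst integral_divide_zero[symmetric]) (simp add: field_simps)
    finally show "(LINT x|lborel. complex_of_real (phi \<gamma> x) * fourier \<psi> x)
      = (LINT t|lborel. complex_of_real ((2 * pi / c) / \<bar>t\<bar> powr (1 + \<gamma>)) * \<psi> t)" .
  qed
  then have "\<exists>A. A \<noteq> 0 \<and> gft_coincides_off_0 (phi \<gamma>) (\<lambda>t. A / \<bar>t\<bar> powr (1 + \<gamma>))"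
    using c by (intro exI[of _ "2 * pi / c"]) auto
  from someI_ex[OF this] show ?thesis unfolding gft_const_def by blast
qed

section \<open>Thin plate spline interpolation\<close>

text \<open>A trivial kernel makes the determinant nonzero and the matrix invertible. This turns
  uniqueness of interpolation into existence.\<close>

lemma square_system_solvable:
  fixes A :: "nat \<Rightarrow> nat \<Rightarrow> real"
  assumes inj: "\<And>v. (\<And>i. i < N \<Longrightarrow> (\<Sum>j<N. A i j * v j) = 0) \<Longrightarrow> \<forall>j<N. v j = 0"
  shows "\<exists>v. \<forall>i<N. (\<Sum>j<N. A i j * v j) = b i"
proof -
  define M where "M = Matrix.mat N N (\<lambda>(i, j). A i j)"
  have M: "M \<in> carrier_mat N N" by (simp add: M_def)
  have mult: "vec_index (M *\<^sub>v v) i = (\<Sum>j<N. A i j * (vec_index v j))" if "i < N" "v \<in> carrier_vec N" for i v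
    using that by (auto simp: M_def scalar_prod_def atLeast0LessThan intro!: sum.cong)
  have "Determinant.det M \<noteq> 0"
  proof
    assume "Determinant.det M = 0"
    then obtain v where v: "v \<in> carrier_vec N" "v \<noteq> 0\<^sub>v N" "M *\<^sub>v v = 0\<^sub>v N"
      using det_0_iff_vec_prod_zero_field[OF M] by auto
    have "(\<Sum>j<N. A i j * (vec_index v j)) = 0" if "i < N" for i
      using mult[OF that v(1)] v(3) that by simp
    then have "\<forall>j<N. vec_index v j = 0" by (rule inj)
    then have "v = 0\<^sub>v N" using v(1) by auto
    with v(2) show False by simp
  qed
  then have "M \<in> Units (ring_mat TYPE(real) N ())"
    by (rule det_non_zero_imp_unit[OF M])
  then obtain B where B: "B \<in> carrier_mat N N" "M * B = 1\<^sub>m N"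
    by (auto simp: Units_def ring_mat_def)
  let ?v = "B *\<^sub>v Matrix.vec N b"
  have v: "?v \<in> carrier_vec N" using B(1) by auto
  have "M *\<^sub>v ?v = (M * B) *\<^sub>v Matrix.vec N b"
    using M B(1) by (simp add: assoc_mult_mat_vec[OF M B(1)])
  also have "\<dots> = Matrix.vec N b" using B(2) by simp
  finally have "(\<Sum>j<N. A i j * (vec_index ?v j)) = b i" if "i < N" for i
    using mult[OF that v] that by simp
  then show ?thesis by (intro exI[of _ "\<lambda>j. vec_index ?v j"]) auto
qed

text \<open>Multiply the equation at knot \<open>i\<close> by \<open>a i\<close> and sum: the side
  conditions remove the affine part, so the quadratic form of \<open>phi 2\<close> is 0 and strict
  positivity kills \<open>a\<close>. The remaining affine function vanishes at the knots 0 and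
  \<open>h\<close>, both present as \<open>n \<ge> 1\<close>.\<close>

lemma tps_coefficients_zero:
  fixes h :: real
  assumes h: "h > 0" and n: "n \<ge> 1"
    and m0: "(\<Sum>k\<le>n. a k) = 0" and m1: "(\<Sum>k\<le>n. real k * a k) = 0"
    and zero: "\<And>i. i \<le> n \<Longrightarrow> (\<Sum>k\<le>n. a k * phi 2 (h * real i - h * real k)) + b0 + b1 * (h * real i) = 0"
  shows "(\<forall>k\<le>n. a k = 0) \<and> b0 = 0 \<and> b1 = 0"
proof -
  have m1': "(\<Sum>k\<le>n. a k * (h * real k)) = 0"
    using m1 by (simp add: mult_ac flip: sum_distrib_left)
  obtain d where "\<And>x. cos_potential 2 x = 1 * phi 2 x + d * x\<^sup>2"
    using cos_potential_eq_phi[of 2] by (metis numeral_less_iff semiring_norm(76,78) zero_less_numeral)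
  from phi_quadratic_form[OF m0 m1' _ _ this]
  have "(LINT t|lborel. (cmod (exp_sum {..n} a (\<lambda>k. h * real k) t))\<^sup>2 / \<bar>t\<bar> powr (1 + 2))
     = (\<Sum>j\<le>n. \<Sum>k\<le>n. a j * a k * phi 2 (h * real j - h * real k))"
    by simp
  also have "\<dots> = (\<Sum>j\<le>n. a j * (\<Sum>k\<le>n. a k * phi 2 (h * real j - h * real k)))"
    by (simp add: sum_distrib_left mult.assoc)
  also have "\<dots> = (\<Sum>j\<le>n. a j * (- b0 - b1 * (h * real j)))"
  proof (rule sum.cong[OF refl])
    fix j assume "j \<in> {..n}"
    then have "(\<Sum>k\<le>n. a k * phi 2 (h * real j - h * real k)) = - b0 - b1 * (h * real j)"
      using zero[of j] by simp
    then show "a j * (\<Sum>k\<le>n. a k * phi 2 (h * real j - h * real k)) = a j * (- b0 - b1 * (h * real j))"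
      by simp
  qed
  also have "\<dots> = - b0 * (\<Sum>j\<le>n. a j) - b1 * (\<Sum>j\<le>n. a j * (h * real j))"
    by (simp add: sum_distrib_left algebra_simps sum_subtractf sum_negf)
  also have "\<dots> = 0" using m0 m1' by simp
  finally have a: "\<forall>k\<le>n. a k = 0"
    by (intro exp_sum_equispaced_integral_zero[where \<gamma>=2, OF _ _ h m0 m1']) simp_all
  then have lin: "b0 + b1 * (h * real i) = 0" if "i \<le> n" for i
    using zero[OF that] by simp
  have "b0 = 0" using lin[of 0] by simp
  moreover have "b1 = 0" using lin[of 1] n h \<open>b0 = 0\<close> by simp
  ultimately show ?thesis using a by blast
qed

section \<open>The spline space and its Lagrange functions\<close>

lemma tps_spaceI:
  assumes "(\<Sum>k\<le>n. a k) = 0" "(\<Sum>k\<le>n. real k * a k) = 0"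
    and "\<And>x. s x = (\<Sum>k\<le>n. a k * phi 2 (x - h * real k)) + b0 + b1 * x"
  shows "s \<in> tps_space h n"
  using assms unfolding tps_space_def atLeast0AtMost by blast

lemma tps_spaceE:
  assumes "s \<in> tps_space h n"
  obtains a b0 b1 where "(\<Sum>k\<le>n. a k) = 0" "(\<Sum>k\<le>n. real k * a k) = 0"
    "\<And>x. s x = (\<Sum>k\<le>n. a k * phi 2 (x - h * real k)) + b0 + b1 * x"
  using assms unfolding tps_space_def atLeast0AtMost by blast

lemma tps_space_affine: "(\<lambda>x. b0 + b1 * x) \<in> tps_space h n"
  by (rule tps_spaceI[where a="\<lambda>_. 0"]) auto

lemma tps_space_add_scale:
  assumes "s \<in> tps_space h n" "s' \<in> tps_space h n"
  shows "(\<lambda>x. s x + w * s' x) \<in> tps_space h n"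
proof -
  obtain a b0 b1 where 1: "(\<Sum>k\<le>n. a k) = 0" "(\<Sum>k\<le>n. real k * a k) = 0"
    "\<And>x. s x = (\<Sum>k\<le>n. a k * phi 2 (x - h * real k)) + b0 + b1 * x"
    using assms(1) by (rule tps_spaceE) blast
  obtain a' b0' b1' where 2: "(\<Sum>k\<le>n. a' k) = 0" "(\<Sum>k\<le>n. real k * a' k) = 0"
    "\<And>x. s' x = (\<Sum>k\<le>n. a' k * phi 2 (x - h * real k)) + b0' + b1' * x"
    using assms(2) by (rule tps_spaceE) blast
  have "(\<Sum>k\<le>n. a k + w * a' k) = (\<Sum>k\<le>n. a k) + w * (\<Sum>k\<le>n. a' k)"
    by (simp add: sum.distrib sum_distrib_left)
  moreover have "(\<Sum>k\<le>n. real k * (a k + w * a' k)) = (\<Sum>k\<le>n. real k * a k) + w * (\<Sum>k\<le>n. real k * a' k)"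
    by (simp add: sum.distrib sum_distrib_left algebra_simps)
  ultimately show ?thesis
    using 1 2 by (intro tps_spaceI[where a="\<lambda>k. a k + w * a' k" and ?b0.0="b0 + w * b0'" and ?b1.0="b1 + w * b1'"])
      (auto simp: sum.distrib sum_distrib_left algebra_simps)
qed

lemma tps_space_sum:
  assumes "finite J" "\<And>j. j \<in> J \<Longrightarrow> l j \<in> tps_space h n"
  shows "(\<lambda>x. \<Sum>j\<in>J. w j * l j x) \<in> tps_space h n"
  using assms
proof (induction J rule: finite_induct)
  case empty
  then show ?case using tps_space_affine[of 0 0] by simp
next
  case (insert j J)
  have "(\<lambda>x. (\<Sum>j\<in>J. w j * l j x) + w j * l j x) \<in> tps_space h n"
    using insert by (intro tps_space_add_scale) auto
  then show ?case using insert by (simp add: add.commute)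
qed

context
  fixes h :: real and n :: nat
  assumes h: "h > 0" and n: "n \<ge> 1"
begin

lemma tps_interpolation_unique:
  assumes "s \<in> tps_space h n" "s' \<in> tps_space h n"
    and "\<And>i. i \<le> n \<Longrightarrow> s (h * real i) = s' (h * real i)"
  shows "s = s'"
proof -
  have "(\<lambda>x. s x + (-1) * s' x) \<in> tps_space h n" by (rule tps_space_add_scale[OF assms(1,2)])
  then obtain a b0 b1 where 1: "(\<Sum>k\<le>n. a k) = 0" "(\<Sum>k\<le>n. real k * a k) = 0"
    "\<And>x. s x + (-1) * s' x = (\<Sum>k\<le>n. a k * phi 2 (x - h * real k)) + b0 + b1 * x"
    by (rule tps_spaceE) blast
  have "(\<forall>k\<le>n. a k = 0) \<and> b0 = 0 \<and> b1 = 0"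
    using 1(3)[symmetric] assms(3) by (intro tps_coefficients_zero[OF h n 1(1,2)]) simp
  then have "s x + (-1) * s' x = 0" for x using 1(3)[of x] by simp
  then show ?thesis by auto
qed

lemma tps_interpolation_exists:
  "\<exists>s\<in>tps_space h n. \<forall>i\<le>n. s (h * real i) = g i"
proof -
  \<comment> \<open>A square system of size \<open>n + 3\<close>. Columns \<open>0..n\<close> carry
    the coefficients of \<open>phi 2\<close>, column \<open>n + 1\<close> the constant, column
    \<open>n + 2\<close> the slope; rows \<open>0..n\<close> are the interpolation conditions, the
    last two the side conditions.\<close>
  define A where "A i j =
    (if i \<le> n then (if j \<le> n then phi 2 (h * real i - h * real j) else if j = Suc n then 1 else h * real i)
     else if i = Suc n then (if j \<le> n then 1 else 0) else (if j \<le> n then real j else 0))" for i j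
  let ?N = "Suc (Suc (Suc n))"
  have sums: "(\<Sum>j<?N. A i j * v j) =
     (if i \<le> n then (\<Sum>j\<le>n. v j * phi 2 (h * real i - h * real j)) + v (Suc n) + v (Suc (Suc n)) * (h * real i)
      else if i = Suc n then (\<Sum>j\<le>n. v j) else (\<Sum>j\<le>n. real j * v j))" for i v
    by (simp add: A_def lessThan_Suc_atMost mult_ac)
  have "\<forall>j<?N. v j = 0" if v: "\<And>i. i < ?N \<Longrightarrow> (\<Sum>j<?N. A i j * v j) = 0" for v
  proof -
    have "(\<forall>k\<le>n. v k = 0) \<and> v (Suc n) = 0 \<and> v (Suc (Suc n)) = 0"
    proof (rule tps_coefficients_zero[OF h n])
      show "(\<Sum>k\<le>n. v k) = 0" using v[of "Suc n"] unfolding sums by simp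
      show "(\<Sum>k\<le>n. real k * v k) = 0" using v[of "Suc (Suc n)"] unfolding sums by simp
      show "(\<Sum>k\<le>n. v k * phi 2 (h * real i - h * real k)) + v (Suc n) + v (Suc (Suc n)) * (h * real i) = 0"
        if "i \<le> n" for i using v[of i] that unfolding sums by simp
    qed
    then show ?thesis by (auto simp: less_Suc_eq_le le_Suc_eq)
  qed
  then obtain v where "\<forall>i<?N. (\<Sum>j<?N. A i j * v j) = (if i \<le> n then g i else 0)"
    using square_system_solvable[of ?N A "\<lambda>i. if i \<le> n then g i else 0"] by blast
  then have v: "\<And>i. i < ?N \<Longrightarrow> (\<Sum>j<?N. A i j * v j) = (if i \<le> n then g i else 0)" by blast
  show ?thesis
  proof (intro bexI allI impI)
    show "(\<lambda>x. (\<Sum>k\<le>n. v k * phi 2 (x - h * real k)) + v (Suc n) + v (Suc (Suc n)) * x) \<in> tps_space h n"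
      using v[of "Suc n"] v[of "Suc (Suc n)"] unfolding sums
      by (intro tps_spaceI[where a=v]) auto
    show "(\<Sum>k\<le>n. v k * phi 2 (h * real i - h * real k)) + v (Suc n) + v (Suc (Suc n)) * (h * real i) = g i"
      if "i \<le> n" for i using v[of i] that unfolding sums by simp
  qed
qed

lemma tps_interpolation_ex1:
  "\<exists>!s. s \<in> tps_space h n \<and> (\<forall>i\<in>{0..n}. s (h * real i) = g i)"
  using tps_interpolation_exists[of g] tps_interpolation_unique by (metis atLeastAtMost_iff le0)

lemma tps_lagrange_in_space: "tps_lagrange h n j \<in> tps_space h n"
  and tps_lagrange_knot: "i \<le> n \<Longrightarrow> tps_lagrange h n j (h * real i) = (if i = j then 1 else 0)"
proof -
  have "tps_lagrange h n j \<in> tps_space h n \<and> (\<forall>i\<in>{0..n}. tps_lagrange h n j (h * real i) = (if i = j then 1 else 0))"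
    unfolding tps_lagrange_def mult.commute[of _ h] by (rule theI'[OF tps_interpolation_ex1])
  then show "tps_lagrange h n j \<in> tps_space h n"
    "i \<le> n \<Longrightarrow> tps_lagrange h n j (h * real i) = (if i = j then 1 else 0)" by auto
qed

text \<open>Both sides lie in the spline space and agree at the knots. Applied to the affine
  functions 1 and \<open>x\<close> it yields the partition of unity and the first moment
  identity.\<close>

lemma tps_lagrange_expansion:
  assumes "s \<in> tps_space h n"
  shows "s x = (\<Sum>j\<le>n. s (h * real j) * tps_lagrange h n j x)"
proof -
  have "s = (\<lambda>x. \<Sum>j\<le>n. s (h * real j) * tps_lagrange h n j x)"
  proof (rule tps_interpolation_unique[OF assms])
    show "(\<lambda>x. \<Sum>j\<le>n. s (h * real j) * tps_lagrange h n j x) \<in> tps_space h n"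
      by (intro tps_space_sum tps_lagrange_in_space) simp
    fix i assume i: "i \<le> n"
    have "(\<Sum>j\<le>n. s (h * real j) * tps_lagrange h n j (h * real i)) = (\<Sum>j\<le>n. if i = j then s (h * real j) else 0)"
      using i by (intro sum.cong) (auto simp: tps_lagrange_knot)
    then show "s (h * real i) = (\<Sum>j\<le>n. s (h * real j) * tps_lagrange h n j (h * real i))"
      using i by simp
  qed
  then show ?thesis by (rule fun_cong)
qed

lemma tps_interpolant_eq_sum:
  "tps_interpolant h n f x = (\<Sum>j\<le>n. f (h * real j) * tps_lagrange h n j x)"
proof -
  have "tps_interpolant h n f \<in> tps_space h n \<and> (\<forall>i\<in>{0..n}. tps_interpolant h n f (h * real i) = f (h * real i))"
    unfolding tps_interpolant_def by (rule theI'[OF tps_interpolation_ex1])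
  then show ?thesis using tps_lagrange_expansion[of "tps_interpolant h n f" x] by simp
qed

lemma tps_lagrange_sum: "(\<Sum>j\<le>n. tps_lagrange h n j x) = 1"
  using tps_lagrange_expansion[OF tps_space_affine[of 1 0], of x] by simp

lemma tps_lagrange_moment: "(\<Sum>j\<le>n. h * real j * tps_lagrange h n j x) = x"
  using tps_lagrange_expansion[OF tps_space_affine[of 0 1], of x] by simp

end

section \<open>The error bound\<close>

text \<open>Integrability comes from \<open>|u v| \<le> u\<^sup>2 + v\<^sup>2\<close>, the
  inequality from the nonnegative quadratic polynomial in \<open>l\<close> given by the integral of
  \<open>(u - l v)\<^sup>2\<close>.\<close>

lemma cauchy_schwarz_integral:
  fixes u v :: "'a \<Rightarrow> real"
  assumes [measurable]: "u \<in> borel_measurable M" "v \<in> borel_measurable M"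
    and u: "integrable M (\<lambda>x. (u x)\<^sup>2)" and v: "integrable M (\<lambda>x. (v x)\<^sup>2)"
  shows "integrable M (\<lambda>x. u x * v x)"
    and "(LINT x|M. u x * v x) \<le> sqrt (LINT x|M. (u x)\<^sup>2) * sqrt (LINT x|M. (v x)\<^sup>2)"
proof -
  show uv: "integrable M (\<lambda>x. u x * v x)"
  proof (rule Bochner_Integration.integrable_bound[OF Bochner_Integration.integrable_add[OF u v]])
    show "AE x in M. norm (u x * v x) \<le> norm ((u x)\<^sup>2 + (v x)\<^sup>2)"
    proof (rule AE_I2)
      fix x
      have "2 * (\<bar>u x\<bar> * \<bar>v x\<bar>) \<le> \<bar>u x\<bar>\<^sup>2 + \<bar>v x\<bar>\<^sup>2"
        using sum_squares_bound[of "\<bar>u x\<bar>" "\<bar>v x\<bar>"] by (simp add: mult.assoc)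
      moreover have "0 \<le> \<bar>u x\<bar> * \<bar>v x\<bar>" by simp
      ultimately have "\<bar>u x\<bar> * \<bar>v x\<bar> \<le> (u x)\<^sup>2 + (v x)\<^sup>2"
        unfolding power2_abs by linarith
      then show "norm (u x * v x) \<le> norm ((u x)\<^sup>2 + (v x)\<^sup>2)"
        by (simp add: abs_mult)
    qed
  qed measurable
  let ?A = "LINT x|M. (u x)\<^sup>2" and ?B = "LINT x|M. u x * v x" and ?C = "LINT x|M. (v x)\<^sup>2"
  have q: "0 \<le> ?A - 2 * l * ?B + l\<^sup>2 * ?C" for l
  proof -
    have "0 \<le> (LINT x|M. (u x - l * v x)\<^sup>2)" by simp
    also have "(\<lambda>x. (u x - l * v x)\<^sup>2) = (\<lambda>x. (u x)\<^sup>2 - 2 * l * (u x * v x) + l\<^sup>2 * (v x)\<^sup>2)"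
      by (simp add: power2_eq_square algebra_simps)
    also have "(LINT x|M. (u x)\<^sup>2 - 2 * l * (u x * v x) + l\<^sup>2 * (v x)\<^sup>2) = ?A - 2 * l * ?B + l\<^sup>2 * ?C"
      using u v uv by simp
    finally show ?thesis .
  qed
  have C0: "?C \<ge> 0" and A0: "?A \<ge> 0" by simp_all
  have "?B\<^sup>2 \<le> ?A * ?C"
  proof (cases "?C = 0")
    case True
    have "?B = 0"
    proof (rule ccontr)
      assume B: "?B \<noteq> 0"
      \<comment> \<open>With \<open>?C = 0\<close> the polynomial is affine in \<open>l\<close>, and
        this \<open>l\<close> gives it the value \<open>-1\<close>.\<close>
      show False using q[of "(?A + 1) / (2 * ?B)"] True B by (simp add: field_simps)
    qed
    then show ?thesis using True by simp
  next
    case False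
    then have "?C > 0" using C0 by linarith
    \<comment> \<open>The minimiser of the polynomial.\<close>
    then show ?thesis using q[of "?B / ?C"] by (simp add: field_simps power2_eq_square)
  qed
  then have "\<bar>?B\<bar> \<le> sqrt (?A * ?C)" by (rule real_le_rsqrt[of "\<bar>?B\<bar>", simplified])
  then show "?B \<le> sqrt ?A * sqrt ?C" by (simp add: real_sqrt_mult)
qed

section \<open>Fourier representation of the interpolation error\<close>

lemma Ck_on_complex_of_real:
  assumes "Ck_on k f S"
  shows "Ck_on k (\<lambda>x. complex_of_real (f x)) S"
proof -
  obtain D where "\<forall>x\<in>S. D 0 x = f x"
    "\<forall>i<k. \<forall>x\<in>S. (D i has_vector_derivative D (Suc i) x) (at x within S)" "continuous_on S (D k)"
    using assms unfolding Ck_on_def by blast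
  then show ?thesis unfolding Ck_on_def
    by (intro exI[of _ "\<lambda>i x. complex_of_real (D i x)"])
      (auto intro!: has_vector_derivative_of_real continuous_intros
        simp: has_real_derivative_iff_has_vector_derivative)
qed

lemma supp_complex_of_real: "supp (\<lambda>x. complex_of_real (f x)) = supp f"
  by (simp add: supp_def)

text \<open>The weight is at most \<open>1 + \<bar>t\<bar> ^ (2 * k)\<close>, so square
  integrability of the transforms of \<open>D 0\<close> and \<open>D k\<close> suffices.\<close>

lemma integrable_fourier_weighted:
  fixes D :: "nat \<Rightarrow> real \<Rightarrow> complex"
  assumes D: "is_Ck_chain k D R" and s: "0 \<le> s" "s \<le> 2 * real k"
  shows "integrable lborel (\<lambda>t. (cmod (fourier (D 0) t))\<^sup>2 * \<bar>t\<bar> powr s)"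
proof -
  have [measurable]: "D 0 \<in> borel_measurable borel" using chain_integrable[OF D, of 0] by simp
  have "integrable lborel (\<lambda>t. \<bar>t\<bar> ^ (2 * 0) * (cmod (fourier (D 0) t))\<^sup>2
      + \<bar>t\<bar> ^ (2 * k) * (cmod (fourier (D 0) t))\<^sup>2)"
    by (intro Bochner_Integration.integrable_add integrable_fourier_chain_square[OF D]) simp_all
  then show ?thesis
  proof (rule Bochner_Integration.integrable_bound)
    show "AE t in lborel. norm ((cmod (fourier (D 0) t))\<^sup>2 * \<bar>t\<bar> powr s)
      \<le> norm (\<bar>t\<bar> ^ (2 * 0) * (cmod (fourier (D 0) t))\<^sup>2 + \<bar>t\<bar> ^ (2 * k) * (cmod (fourier (D 0) t))\<^sup>2)"
    proof (rule AE_I2)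
      fix t :: real
      have "\<bar>t\<bar> powr s \<le> 1 + \<bar>t\<bar> ^ (2 * k)"
      proof (cases "\<bar>t\<bar> \<le> 1")
        case True
        then have "\<bar>t\<bar> powr s \<le> 1" using s by (intro powr_le1) auto
        then show ?thesis by (rule add_increasing2[rotated]) simp
      next
        case False
        then have "\<bar>t\<bar> powr s \<le> \<bar>t\<bar> powr (real (2 * k))" using s by (intro powr_mono) auto
        also have "\<dots> = \<bar>t\<bar> ^ (2 * k)" using False by (intro powr_realpow) auto
        finally show ?thesis by (rule add_increasing[rotated]) simp
      qed
      then have "(cmod (fourier (D 0) t))\<^sup>2 * \<bar>t\<bar> powr s \<le> (cmod (fourier (D 0) t))\<^sup>2 * (1 + \<bar>t\<bar> ^ (2 * k))"
        by (rule mult_left_mono) simp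
      then show "norm ((cmod (fourier (D 0) t))\<^sup>2 * \<bar>t\<bar> powr s)
        \<le> norm (\<bar>t\<bar> ^ (2 * 0) * (cmod (fourier (D 0) t))\<^sup>2 + \<bar>t\<bar> ^ (2 * k) * (cmod (fourier (D 0) t))\<^sup>2)"
        by (simp add: algebra_simps abs_mult)
    qed
  qed measurable
qed

text \<open>The index \<open>Suc n\<close> adds the evaluation point \<open>x\<close> with weight 1
  to the \<open>n + 1\<close> knots. Indexing by numbers rather than points lets \<open>x\<close>
  coincide with a knot.\<close>

lemma Theta_eq_exp_sum:
  "Theta h n x = exp_sum {..Suc n} (\<lambda>j. if j \<le> n then - tps_lagrange h n j x else 1)
     (\<lambda>j. if j \<le> n then h * real j else x)"
  by (simp add: fun_eq_iff Theta_def exp_sum_def cis_conv_exp atLeast0AtMost sum_negf)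

text \<open>Partition of unity and reproduction of \<open>x\<close> are exactly the vanishing
  moments of order 0 and 1.\<close>

lemma integrable_Theta_square:
  assumes "h > 0" "n \<ge> 1" "0 < \<mu>" "\<mu> < 4"
  shows "integrable lborel (\<lambda>t. (cmod (Theta h n x t))\<^sup>2 / \<bar>t\<bar> powr (1 + \<mu>))"
proof -
  let ?a = "\<lambda>j. if j \<le> n then - tps_lagrange h n j x else 1" and ?p = "\<lambda>j. if j \<le> n then h * real j else x"
  have "(\<Sum>j\<le>Suc n. ?a j) = 0" "(\<Sum>j\<le>Suc n. ?a j * ?p j) = 0"
    using tps_lagrange_sum[OF assms(1,2), of x] tps_lagrange_moment[OF assms(1,2), of x]
    by (simp_all add: sum_negf mult.commute)
  from has_bochner_integral_exp_sum_square[OF this assms(3,4)] show ?thesis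
    unfolding Theta_eq_exp_sum by (simp add: has_bochner_integral_iff)
qed

text \<open>Inversion at \<open>x\<close> and at every knot, combined with the weights in
  \<open>Theta\<close>, rebuilds \<open>g x\<close> minus the Lagrange form of the
  interpolant.\<close>

lemma tps_error_eq_integral:
  fixes D :: "nat \<Rightarrow> real \<Rightarrow> complex"
  assumes h: "h > 0" "n \<ge> 1" and D: "is_Ck_chain k D R" "2 \<le> k" and g: "D 0 = (\<lambda>x. complex_of_real (g x))"
  shows "(LINT t|lborel. fourier (D 0) t * Theta h n x t) = complex_of_real (2 * pi * (g x - tps_interpolant h n g x))"
proof -
  have gi: "integrable lborel (D 0)" using chain_integrable[OF D(1), of 0] by simp
  then have [measurable]: "D 0 \<in> borel_measurable borel" by simp
  have i: "integrable lborel (fourier (D 0))"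
    by (rule Bochner_Integration.integrable_bound[OF integrable_fourier_chain[OF D(1), of 0]]) (use D in auto)
  have inv: "has_bochner_integral lborel (\<lambda>t. fourier (D 0) t * cis (y * t)) (2 * pi * D 0 y)" for y
    using fourier_inversion_chain[OF D(1), of 0 y] D(2) integrable_cis_mult[OF i, of "\<lambda>t. y * t"]
    by (auto simp: has_bochner_integral_iff mult.commute)
  have "has_bochner_integral lborel (\<lambda>t. fourier (D 0) t * cis (x * t)
       - (\<Sum>j\<le>n. complex_of_real (tps_lagrange h n j x) * (fourier (D 0) t * cis (h * real j * t))))
     (2 * pi * D 0 x - (\<Sum>j\<le>n. complex_of_real (tps_lagrange h n j x) * (2 * pi * D 0 (h * real j))))"
    by (intro has_bochner_integral_diff has_bochner_integral_sum has_bochner_integral_mult_right inv)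
  moreover have "fourier (D 0) t * cis (x * t)
       - (\<Sum>j\<le>n. complex_of_real (tps_lagrange h n j x) * (fourier (D 0) t * cis (h * real j * t)))
     = fourier (D 0) t * Theta h n x t" for t
    by (simp add: Theta_def cis_conv_exp atLeast0AtMost right_diff_distrib sum_distrib_left mult_ac)
  moreover have "2 * pi * D 0 x - (\<Sum>j\<le>n. complex_of_real (tps_lagrange h n j x) * (2 * pi * D 0 (h * real j)))
     = complex_of_real (2 * pi * (g x - tps_interpolant h n g x))"
    unfolding g tps_interpolant_eq_sum[OF h]
    by (simp add: right_diff_distrib sum_distrib_left mult_ac)
  ultimately show ?thesis by (simp add: has_bochner_integral_iff)
qed

theorem mainTheorem2:
  fixes n :: nat and h \<mu> :: real and \<kappa> :: nat and f fstar :: "real \<Rightarrow> real"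
  assumes "n \<ge> 1"
    and "h = 1 / real n"
    and "0 < \<mu>" and "\<mu> < 4"
    and "\<kappa> = nat \<lceil>\<mu> / 2 + 1\<rceil>"
    and "Ck_on \<kappa> f {0..1}"
    and "Ck_on \<kappa> fstar UNIV"
    and "compact (supp fstar)"
    and "\<forall>x\<in>{0..1}. fstar x = f x"
  shows "integrable lborel
           (\<lambda>t. (cmod (fourier (\<lambda>x. complex_of_real (fstar x)) t))\<^sup>2 * \<bar>t\<bar> powr (1 + \<mu>))
         \<and> (\<forall>x\<in>{0..1}. \<bar>f x - tps_interpolant h n f x\<bar>
                        \<le> error_const fstar \<mu> * mixed_power h n \<mu> x)"
proof -
  let ?g = "\<lambda>x. complex_of_real (fstar x)"
  have h: "h > 0" using assms(1,2) by simp
  \<comment> \<open>The first bound gives \<open>1 + \<mu> \<le> 2 * \<kappa>\<close> for the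
    weighted integral. The second holds as \<open>0 < \<mu>\<close> pushes the ceiling above 1, and
    Fourier inversion requires it.\<close>
  have \<kappa>: "\<mu> / 2 + 1 \<le> real \<kappa>" "2 \<le> \<kappa>" using assms(3,5) by linarith+
  obtain D R where D: "D 0 = ?g" "is_Ck_chain \<kappa> D R"
    using Ck_on_compact_supp_chain[OF Ck_on_complex_of_real[OF assms(7)]] assms(8)
    unfolding supp_complex_of_real by metis
  have [measurable]: "?g \<in> borel_measurable borel" using chain_integrable[OF D(2), of 0] D(1) by simp
  have U: "integrable lborel (\<lambda>t. (cmod (fourier ?g t))\<^sup>2 * \<bar>t\<bar> powr (1 + \<mu>))"
    using integrable_fourier_weighted[OF D(2), of "1 + \<mu>"] \<kappa> assms(3) unfolding D(1) by simp
  have "\<bar>f x - tps_interpolant h n f x\<bar> \<le> error_const fstar \<mu> * mixed_power h n \<mu> x"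
    if x: "x \<in> {0..1}" for x
  proof -
    have V: "integrable lborel (\<lambda>t. (cmod (Theta h n x t))\<^sup>2 / \<bar>t\<bar> powr (1 + \<mu>))"
      by (rule integrable_Theta_square[OF h assms(1,3,4)])
    have [measurable]: "Theta h n x \<in> borel_measurable borel"
      unfolding Theta_eq_exp_sum exp_sum_def by measurable
    \<comment> \<open>Half of the weight goes to each factor, so that the squares are the integrands
      of \<open>error_const\<close> and \<open>mixed_power\<close>.\<close>
    let ?u = "\<lambda>t. cmod (fourier ?g t) * \<bar>t\<bar> powr ((1 + \<mu>) / 2)"
    let ?v = "\<lambda>t. cmod (Theta h n x t) / \<bar>t\<bar> powr ((1 + \<mu>) / 2)"
    let ?U = "LINT t|lborel. (cmod (fourier ?g t))\<^sup>2 * \<bar>t\<bar> powr (1 + \<mu>)"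
    let ?V = "LINT t|lborel. (cmod (Theta h n x t))\<^sup>2 / \<bar>t\<bar> powr (1 + \<mu>)"
    have sq: "(\<bar>t\<bar> powr ((1 + \<mu>) / 2))\<^sup>2 = \<bar>t\<bar> powr (1 + \<mu>)" for t :: real
      by (simp add: power2_eq_square flip: powr_add)
    have u2: "(\<lambda>t. (?u t)\<^sup>2) = (\<lambda>t. (cmod (fourier ?g t))\<^sup>2 * \<bar>t\<bar> powr (1 + \<mu>))"
      unfolding power_mult_distrib sq ..
    have v2: "(\<lambda>t. (?v t)\<^sup>2) = (\<lambda>t. (cmod (Theta h n x t))\<^sup>2 / \<bar>t\<bar> powr (1 + \<mu>))"
      unfolding power_divide sq ..
    have "?u \<in> borel_measurable lborel" "?v \<in> borel_measurable lborel" by measurable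
    note CS = cauchy_schwarz_integral[OF this, unfolded u2 v2, OF U V]
    \<comment> \<open>All knots lie in \<open>[0, 1]\<close>, so \<open>f\<close> and
      \<open>fstar\<close> have the same interpolant.\<close>
    have "f (h * real j) = fstar (h * real j)" if "j \<le> n" for j
    proof -
      have "h * real j \<in> {0..1}" unfolding assms(2) using assms(1) that by simp
      then show ?thesis using assms(9) by simp
    qed
    then have "tps_interpolant h n f x = tps_interpolant h n fstar x"
      unfolding tps_interpolant_eq_sum[OF h assms(1)] by (intro sum.cong) auto
    then have "\<bar>2 * pi * (f x - tps_interpolant h n f x)\<bar> = cmod (LINT t|lborel. fourier ?g t * Theta h n x t)"
      using tps_error_eq_integral[OF h assms(1) D(2) \<kappa>(2) D(1), of x] assms(9) x
      unfolding D(1) by (simp only: norm_of_real)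
    also have "\<dots> \<le> (LINT t|lborel. cmod (fourier ?g t * Theta h n x t))" by (rule integral_norm_bound)
    also have "\<dots> = (LINT t|lborel. ?u t * ?v t)"
    proof (rule integral_cong_AE)
      \<comment> \<open>At \<open>t = 0\<close> both powers take the default value 0, so they are
        cancelled only off this null set.\<close>
      show "AE t in lborel. cmod (fourier ?g t * Theta h n x t) = ?u t * ?v t"
        using AE_lborel_singleton[of 0] by eventually_elim (simp add: norm_mult)
    qed measurable
    also have "\<dots> \<le> sqrt ?U * sqrt ?V" by (rule CS)
    finally have main: "2 * pi * \<bar>f x - tps_interpolant h n f x\<bar> \<le> sqrt ?U * sqrt ?V"
      by (simp add: abs_mult)
    let ?A = "\<bar>gft_const \<mu>\<bar>"
    have A: "?A > 0" using gft_const_nonzero[OF assms(3,4)] by simp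
    \<comment> \<open>The prefactors \<open>1 / (2 * pi * ?A)\<close> and
      \<open>?A / (2 * pi)\<close> multiply to \<open>(1 / (2 * pi))\<^sup>2\<close>, as
      \<open>?A\<close> is nonzero.\<close>
    have "error_const fstar \<mu> * mixed_power h n \<mu> x = sqrt ((1 / (2 * pi))\<^sup>2 * (?U * ?V))"
      unfolding error_const_def mixed_power_def real_sqrt_mult[symmetric]
      using A by (simp add: field_simps power2_eq_square)
    also have "\<dots> = sqrt ?U * sqrt ?V / (2 * pi)"
      by (simp add: real_sqrt_mult)
    finally show ?thesis using main by (simp add: pos_le_divide_eq mult.commute)
  qed
  then show ?thesis using U by blast
qed

end
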